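(* Let $G$ be a topological abelian group, let $\mu : G\to\mathbb{C}\setminus\{0\}$ be a continuous character of $G$, and let $\mathcal{H}$ be a complex Hilbert space. Let $\Phi : G\to \mathbf{B}(\mathcal{H})$ be a hermitian operator-valued $\mu$-cosine function. Then there exists a multiplicative operator $M : G\to \mathbf{B}(\mathcal{H})$ such that $$\Phi(x)=\frac{M(x)+\mu(x)M(-x)}{2}\quad\text{for all } x\in G.$$
   Context: The group $G$ is written additively with neutral element $e$. A continuous character $\mu$ of $G$ is a continuous group homomorphism $\mu: G\to\mathbb{C}\setminus\{0\}$ (in particular $\mu(e)=1$; $\mu$ is not assumed unitary). $\mathbf{B}(\mathcal{H})$ is the algebra of all continuous linear operators of $\mathcal{H}$ into itself, with the usual operator norm, and $I$ is its identity. An operator-valued $\mu$-cosine function is a continuous mapping $\Phi: G\to\mathbf{B}(\mathcal{H})$ satisfying $\Phi(x+y)+\mu(y)\Phi(x-y)=2\Phi(x)\Phi(y)$ for all $x,y\in G$ and $\Phi(e)=I$. A mapping $\Phi: G\to\mathbf{B}(\mathcal{H})$ is hermitian if $\Phi(x)^{*}=\Phi(-x)$ for all $x\in G$, where $\Phi(x)^{*}$ is the adjoint of $\Phi(x)$. A multiplicative operator is a continuous mapping $M: G\to\mathbf{B}(\mathcal{H})$ with $M(x+y)=M(x)M(y)$ for all $x,y\in G$ and $M(e)=I$. *)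

theory Defs
  imports "HOL-Analysis.Analysis"
begin

class complex_vector = real_vector +
  fixes scaleC :: "complex \<Rightarrow> 'a \<Rightarrow> 'a" (infixr \<open>*\<^sub>C\<close> 75)
  assumes scaleC_add_right: "a *\<^sub>C (x + y) = a *\<^sub>C x + a *\<^sub>C y"
    and scaleC_add_left: "(a + b) *\<^sub>C x = a *\<^sub>C x + b *\<^sub>C x"
    and scaleC_scaleC: "a *\<^sub>C (b *\<^sub>C x) = (a * b) *\<^sub>C x"
    and scaleR_scaleC: "r *\<^sub>R x = complex_of_real r *\<^sub>C x"

class complex_normed_vector = complex_vector + real_normed_vector +
  assumes norm_scaleC: "norm (a *\<^sub>C x) = cmod a * norm x"

text \<open>The inner product is linear in the first and conjugate-linear in the second argument.\<close>

class complex_inner = complex_normed_vector +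
  fixes cinner :: "'a \<Rightarrow> 'a \<Rightarrow> complex"
  assumes cinner_commute: "cinner x y = cnj (cinner y x)"
    and cinner_add_left: "cinner (x + y) z = cinner x z + cinner y z"
    and cinner_scaleC_left: "cinner (a *\<^sub>C x) y = a * cinner x y"
    and cinner_ge_zero: "0 \<le> Re (cinner x x)"
    and cinner_eq_zero_iff: "cinner x x = 0 \<longleftrightarrow> x = 0"
    and norm_eq_sqrt_cinner: "norm x = sqrt (Re (cinner x x))"

class chilbert_space = complex_inner + complete_space

instantiation complex :: chilbert_space
begin

definition scaleC_complex :: "complex \<Rightarrow> complex \<Rightarrow> complex"
  where "scaleC_complex a x = a * x"

definition cinner_complex :: "complex \<Rightarrow> complex \<Rightarrow> complex"
  where "cinner_complex x y = x * cnj y"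

instance
proof
  fix a b x y z :: complex and r :: real
  show "a *\<^sub>C (x + y) = a *\<^sub>C x + a *\<^sub>C y" "(a + b) *\<^sub>C x = a *\<^sub>C x + b *\<^sub>C x"
    "a *\<^sub>C (b *\<^sub>C x) = (a * b) *\<^sub>C x" "r *\<^sub>R x = complex_of_real r *\<^sub>C x"
    "norm (a *\<^sub>C x) = cmod a * norm x"
    by (simp_all add: scaleC_complex_def algebra_simps scaleR_conv_of_real norm_mult)
  show "cinner x y = cnj (cinner y x)" "cinner (x + y) z = cinner x z + cinner y z"
    "cinner (a *\<^sub>C x) y = a * cinner x y" "0 \<le> Re (cinner x x)"
    "cinner x x = 0 \<longleftrightarrow> x = 0" "norm x = sqrt (Re (cinner x x))"
    by (simp_all add: cinner_complex_def scaleC_complex_def distrib_right cmod_def power2_eq_square)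
qed

end

lemma bounded_linear_scaleC: "bounded_linear ((*\<^sub>C) a :: 'a::complex_normed_vector \<Rightarrow> 'a)"
  by (rule bounded_linear_intro[where K = "cmod a"])
    (simp_all add: scaleC_add_right scaleR_scaleC scaleC_scaleC norm_scaleC mult.commute)

instantiation blinfun :: (real_normed_vector, complex_normed_vector) complex_normed_vector
begin

lift_definition scaleC_blinfun :: "complex \<Rightarrow> 'a \<Rightarrow>\<^sub>L 'b \<Rightarrow> 'a \<Rightarrow>\<^sub>L 'b"
  is "\<lambda>a f x. a *\<^sub>C f x"
  by (rule bounded_linear_compose[OF bounded_linear_scaleC])

lemma norm_scaleC_blinfun_le: "norm (a *\<^sub>C f) \<le> cmod a * norm f" for f :: "'a \<Rightarrow>\<^sub>L 'b"
proof (rule norm_blinfun_bound)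
  show "norm (blinfun_apply (a *\<^sub>C f) x) \<le> cmod a * norm f * norm x" for x
    using mult_left_mono[OF norm_blinfun[of f x], of "cmod a"]
    by (simp add: scaleC_blinfun.rep_eq norm_scaleC mult.assoc)
qed simp

instance
proof
  fix a b :: complex and x y :: "'a \<Rightarrow>\<^sub>L 'b" and r :: real
  show "a *\<^sub>C (x + y) = a *\<^sub>C x + a *\<^sub>C y"
    by transfer (simp add: scaleC_add_right)
  show "(a + b) *\<^sub>C x = a *\<^sub>C x + b *\<^sub>C x"
    by transfer (simp add: scaleC_add_left)
  show assoc: "c *\<^sub>C (d *\<^sub>C z) = (c * d) *\<^sub>C z" for c d and z :: "'a \<Rightarrow>\<^sub>L 'b"
    by transfer (simp add: scaleC_scaleC)
  show real: "s *\<^sub>R z = complex_of_real s *\<^sub>C z" for s and z :: "'a \<Rightarrow>\<^sub>L 'b"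
    by transfer (simp add: scaleR_scaleC)
  show "norm (a *\<^sub>C x) = cmod a * norm x"
  proof (cases "a = 0")
    case True
    then show ?thesis using real[of 0 x] by simp
  next
    case False
    have "x = inverse a *\<^sub>C (a *\<^sub>C x)"
      using False real[of 1 x] by (simp add: assoc)
    then have "norm x \<le> cmod (inverse a) * norm (a *\<^sub>C x)"
      by (metis norm_scaleC_blinfun_le)
    then have "cmod a * norm x \<le> norm (a *\<^sub>C x)"
      using mult_left_mono[of "norm x" "cmod (inverse a) * norm (a *\<^sub>C x)" "cmod a"] False
      by (simp add: norm_inverse flip: mult.assoc)
    with norm_scaleC_blinfun_le[of a x] show ?thesis by simp
  qed
qed

end

text \<open>
  The type \<open>'h \<Rightarrow>\<^sub>L 'h\<close> consists of the bounded real-linear operators, with the operator norm;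
  \<open>\<B>(H)\<close> is its subalgebra of complex-linear operators.
\<close>

definition bounded_operators :: "('h::complex_normed_vector \<Rightarrow>\<^sub>L 'h) set"
  where "bounded_operators = {T. \<forall>a x. blinfun_apply T (a *\<^sub>C x) = a *\<^sub>C blinfun_apply T x}"

definition cadjoint :: "('h::chilbert_space \<Rightarrow>\<^sub>L 'h) \<Rightarrow> ('h \<Rightarrow>\<^sub>L 'h)"
  where "cadjoint T =
    (THE S. \<forall>x y. cinner (blinfun_apply T x) y = cinner x (blinfun_apply S y))"

definition continuous_character :: "('g::topological_ab_group_add \<Rightarrow> complex) \<Rightarrow> bool"
  where "continuous_character \<mu> \<longleftrightarrow>
    continuous_on UNIV \<mu> \<and> (\<forall>x. \<mu> x \<noteq> 0) \<and> (\<forall>x y. \<mu> (x + y) = \<mu> x * \<mu> y)"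

definition operator_cosine_function ::
    "('g::topological_ab_group_add \<Rightarrow> complex) \<Rightarrow> ('g \<Rightarrow> 'h::chilbert_space \<Rightarrow>\<^sub>L 'h) \<Rightarrow> bool"
  where "operator_cosine_function \<mu> \<Phi> \<longleftrightarrow>
    (\<forall>x. \<Phi> x \<in> bounded_operators) \<and> continuous_on UNIV \<Phi> \<and>
    (\<forall>x y. \<Phi> (x + y) + \<mu> y *\<^sub>C \<Phi> (x - y) = 2 *\<^sub>R (\<Phi> x o\<^sub>L \<Phi> y)) \<and>
    \<Phi> 0 = id_blinfun"

definition hermitian :: "('g::topological_ab_group_add \<Rightarrow> 'h::chilbert_space \<Rightarrow>\<^sub>L 'h) \<Rightarrow> bool"
  where "hermitian \<Phi> \<longleftrightarrow> (\<forall>x. cadjoint (\<Phi> x) = \<Phi> (- x))"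

definition multiplicative_operator ::
    "('g::topological_ab_group_add \<Rightarrow> 'h::chilbert_space \<Rightarrow>\<^sub>L 'h) \<Rightarrow> bool"
  where "multiplicative_operator M \<longleftrightarrow>
    (\<forall>x. M x \<in> bounded_operators) \<and> continuous_on UNIV M \<and>
    (\<forall>x y. M (x + y) = M x o\<^sub>L M y) \<and> M 0 = id_blinfun"

lemma cinner_add_right: "cinner x (y + z) = cinner x y + cinner x z"
  for x y z :: "'a::complex_inner"
  by (metis cinner_commute cinner_add_left complex_cnj_add)

lemma cinner_scaleC_right: "cinner x (a *\<^sub>C y) = cnj a * cinner x y"
  for x y :: "'a::complex_inner"
  by (metis cinner_commute cinner_scaleC_left complex_cnj_mult)

lemma cinner_scaleR_left: "cinner (r *\<^sub>R x) y = of_real r * cinner x y"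
  for x y :: "'a::complex_inner"
  by (simp add: scaleR_scaleC cinner_scaleC_left)

lemma cinner_scaleR_right: "cinner x (r *\<^sub>R y) = of_real r * cinner x y"
  for x y :: "'a::complex_inner"
  by (simp add: scaleR_scaleC cinner_scaleC_right)

lemma cinner_diff_left: "cinner (x - y) z = cinner x z - cinner y z"
  for x y z :: "'a::complex_inner"
  using cinner_add_left[of "x - y" y z] by simp

lemma cinner_diff_right: "cinner x (y - z) = cinner x y - cinner x z"
  for x y z :: "'a::complex_inner"
  using cinner_add_right[of x "y - z" z] by simp

lemma power2_norm_eq_cinner: "(norm x)\<^sup>2 = Re (cinner x x)"
  for x :: "'a::complex_inner"
  by (simp add: norm_eq_sqrt_cinner cinner_ge_zero)

lemma Re_cinner_commute: "Re (cinner x y) = Re (cinner y x)"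
  for x y :: "'a::complex_inner"
  by (subst cinner_commute) simp

lemma norm_add_square: "(norm (x + y))\<^sup>2 = (norm x)\<^sup>2 + 2 * Re (cinner x y) + (norm y)\<^sup>2"
  for x y :: "'a::complex_inner"
  by (simp add: power2_norm_eq_cinner cinner_add_left cinner_add_right Re_cinner_commute[of y x])

lemma norm_diff_square: "(norm (x - y))\<^sup>2 = (norm x)\<^sup>2 - 2 * Re (cinner x y) + (norm y)\<^sup>2"
  for x y :: "'a::complex_inner"
  by (simp add: power2_norm_eq_cinner cinner_diff_left cinner_diff_right Re_cinner_commute[of y x])

lemma Re_cinner_le: "Re (cinner x y) \<le> norm x * norm y" for x y :: "'a::complex_inner"
proof -
  have "(norm (x + y))\<^sup>2 \<le> (norm x + norm y)\<^sup>2"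
    by (simp add: norm_triangle_ineq power_mono)
  then show ?thesis by (simp add: norm_add_square power2_sum)
qed

lemma cinner_ext:
  fixes y z :: "'a::complex_inner"
  assumes "\<And>x. cinner x y = cinner x z"
  shows "y = z"
  using assms[of "y - z"] cinner_eq_zero_iff[of "y - z"] by (simp add: cinner_diff_right)

lemma riesz_representation_real:
  fixes f :: "'a::chilbert_space \<Rightarrow> real"
  assumes "bounded_linear f"
  shows "\<exists>z. \<forall>x. f x = Re (cinner x z)"
proof -
  interpret bounded_linear f by fact
  define J where "J x = (norm x)\<^sup>2 - 2 * f x" for x
  define d where "d = (INF x. J x)"
  have J_lb: "- (onorm f)\<^sup>2 \<le> J x" for x
  proof -
    have "f x \<le> onorm f * norm x"
      using onorm[OF assms, of x] by simp
    moreover have "0 \<le> (norm x - onorm f)\<^sup>2" by simp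
    ultimately show ?thesis by (simp add: J_def power2_diff algebra_simps)
  qed
  then have bdd: "bdd_below (range J)" by (rule bdd_belowI2)
  have d_le: "d \<le> J x" for x
    unfolding d_def by (rule cINF_lower[OF bdd]) simp
  have "\<exists>x. J x < d + e" if "e > 0" for e
    using cINF_less_iff[OF _ bdd, of "d + e"] that by (auto simp: d_def)
  then have "\<exists>x. J x < d + 1 / real (Suc n)" for n by simp
  then obtain X where X: "\<And>n. J (X n) < d + 1 / real (Suc n)" by metis
  have dist_bound: "(norm (x - y))\<^sup>2 \<le> 2 * (J x - d) + 2 * (J y - d)" for x y
  proof -
    have mid: "4 * (norm ((1/2) *\<^sub>R (x + y)))\<^sup>2 = (norm (x + y))\<^sup>2"
      by (simp add: power_mult_distrib power2_eq_square)
    have "4 * d \<le> 4 * J ((1/2) *\<^sub>R (x + y))" using d_le by simp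
    also have "\<dots> = (norm (x + y))\<^sup>2 - 4 * f x - 4 * f y"
      unfolding J_def right_diff_distrib mid by (simp add: scaleR add field_simps)
    finally show ?thesis
      using norm_add_square[of x y] norm_diff_square[of x y] by (simp add: J_def)
  qed
  have "Cauchy X"
  proof (rule CauchyI)
    fix e :: real assume "0 < e"
    then obtain N where N: "inverse (real (Suc N)) < e\<^sup>2 / 4"
      using reals_Archimedean[of "e\<^sup>2 / 4"] by auto
    have "norm (X m - X n) < e" if "m \<ge> N" "n \<ge> N" for m n
    proof -
      have close: "J (X k) - d < e\<^sup>2 / 4" if "k \<ge> N" for k
      proof -
        have "1 / real (Suc k) \<le> inverse (real (Suc N))"
          using that by (simp add: inverse_eq_divide frac_le)
        with X[of k] N show ?thesis by linarith
      qed
      have "(norm (X m - X n))\<^sup>2 < e\<^sup>2"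
        using dist_bound[of "X m" "X n"] close[OF that(1)] close[OF that(2)]
        by (simp add: field_simps)
      then show ?thesis using \<open>0 < e\<close> by (simp add: power2_less_imp_less)
    qed
    then show "\<exists>M. \<forall>m\<ge>M. \<forall>n\<ge>M. norm (X m - X n) < e" by blast
  qed
  then obtain z where z: "X \<longlonglongrightarrow> z"
    using Cauchy_convergent convergent_def by blast
  have "(\<lambda>n. J (X n)) \<longlonglongrightarrow> J z"
    unfolding J_def by (intro tendsto_intros tendsto z)
  moreover have "(\<lambda>n. d + 1 / real (Suc n)) \<longlonglongrightarrow> d + 0"
    by (intro tendsto_add tendsto_const LIMSEQ_Suc lim_1_over_n)
  ultimately have "J z \<le> d + 0"
    by (rule LIMSEQ_le) (use X in \<open>auto intro: less_imp_le\<close>)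
  then have J_min: "J z \<le> J x" for x using d_le[of x] by simp
  have le: "f h \<le> Re (cinner h z)" for h
  proof (rule ccontr)
    assume "\<not> ?thesis"
    then have c: "0 < f h - Re (cinner h z)" (is "0 < ?c") by simp
    have "cinner 0 z = 0" using cinner_scaleR_left[of 0 0 z] by simp
    with c have "h \<noteq> 0" by (auto simp: zero)
    then have h: "0 < (norm h)\<^sup>2" by simp
    define t where "t = ?c / (norm h)\<^sup>2"
    have "J (z + t *\<^sub>R h) = J z + t\<^sup>2 * (norm h)\<^sup>2 - 2 * t * ?c"
      by (simp add: J_def norm_add_square add scaleR cinner_scaleR_right
          Re_cinner_commute[of z h] power_mult_distrib algebra_simps)
    also have "\<dots> = J z - ?c\<^sup>2 / (norm h)\<^sup>2"
    proof -
      have "t * (norm h)\<^sup>2 = ?c" using h by (simp add: t_def)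
      then have "t\<^sup>2 * (norm h)\<^sup>2 = t * ?c" by (metis mult.assoc power2_eq_square)
      moreover have "t * ?c = ?c\<^sup>2 / (norm h)\<^sup>2" by (simp add: t_def power2_eq_square)
      ultimately show ?thesis by simp
    qed
    also have "\<dots> < J z" using c h by simp
    finally show False using J_min[of "z + t *\<^sub>R h"] by simp
  qed
  have "f x = Re (cinner x z)" for x
    using le[of x] le[of "- x"] cinner_diff_left[of 0 x z] cinner_scaleR_left[of 0 0 z]
      linear_neg[OF bounded_linear.linear[OF assms], of x]
    by simp
  then show ?thesis by blast
qed

lemma cadjoint_exists:
  fixes T :: "'h::chilbert_space \<Rightarrow>\<^sub>L 'h"
  assumes T: "T \<in> bounded_operators"
  shows "\<exists>S \<in> bounded_operators. \<forall>x y. cinner (blinfun_apply T x) y = cinner x (blinfun_apply S y)"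
proof -
  have "\<exists>z. \<forall>x. cinner (blinfun_apply T x) y = cinner x z" for y
  proof -
    have "bounded_linear (\<lambda>x. Re (cinner (blinfun_apply T x) y))"
    proof (rule bounded_linear_intro[where K = "norm T * norm y"])
      fix x
      have "\<bar>Re (cinner u y)\<bar> \<le> norm u * norm y" for u
        using Re_cinner_le[of u y] Re_cinner_le[of "- u" y]
          cinner_diff_left[of 0 u y] cinner_scaleR_left[of 0 0 y]
        by (simp add: abs_le_iff)
      also have "norm (blinfun_apply T x) * norm y \<le> norm x * (norm T * norm y)"
        using mult_right_mono[OF norm_blinfun[of T x], of "norm y"] by (simp add: mult_ac)
      finally show "norm (Re (cinner (blinfun_apply T x) y)) \<le> norm x * (norm T * norm y)"
        by simp
    qed (simp_all add: blinfun.bilinear_simps cinner_add_left cinner_scaleR_left)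
    then obtain z where z: "\<And>x. Re (cinner (blinfun_apply T x) y) = Re (cinner x z)"
      using riesz_representation_real by blast
    have "cinner (blinfun_apply T x) y = cinner x z" for x
    proof (rule complex_eqI)
      have "Re (cinner (blinfun_apply T (\<i> *\<^sub>C x)) y) = Re (cinner (\<i> *\<^sub>C x) z)" by (rule z)
      then show "Im (cinner (blinfun_apply T x) y) = Im (cinner x z)"
        using T by (simp add: bounded_operators_def cinner_scaleC_left)
    qed (rule z)
    then show ?thesis by blast
  qed
  then obtain s where s: "\<And>x y. cinner (blinfun_apply T x) y = cinner x (s y)" by metis
  have s_add: "s (x + y) = s x + s y" for x y
    by (rule cinner_ext) (simp flip: s add: cinner_add_right)
  have s_scaleC: "s (a *\<^sub>C x) = a *\<^sub>C s x" for a x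
    by (rule cinner_ext) (simp flip: s add: cinner_scaleC_right)
  have "bounded_linear s"
  proof (rule bounded_linear_intro[where K = "norm T"])
    fix y
    have "norm (s y) * norm (s y) = Re (cinner (blinfun_apply T (s y)) y)"
      using power2_norm_eq_cinner[of "s y"] by (simp add: s power2_eq_square)
    also have "\<dots> \<le> norm (blinfun_apply T (s y)) * norm y" by (rule Re_cinner_le)
    also have "\<dots> \<le> (norm T * norm (s y)) * norm y"
      by (intro mult_right_mono norm_blinfun) simp
    finally have "norm (s y) * norm (s y) \<le> norm (s y) * (norm y * norm T)"
      by (simp add: mult_ac)
    then show "norm (s y) \<le> norm y * norm T"
      by (cases "norm (s y) = 0") (simp_all add: mult_le_cancel_left)
  qed (simp_all add: s_add scaleR_scaleC s_scaleC)
  then show ?thesis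
    by (intro bexI[of _ "Blinfun s"])
      (auto simp: bounded_linear_Blinfun_apply s s_scaleC bounded_operators_def)
qed

lemma
  fixes T :: "'h::chilbert_space \<Rightarrow>\<^sub>L 'h"
  assumes "T \<in> bounded_operators"
  shows cinner_cadjoint: "cinner (blinfun_apply T x) y = cinner x (blinfun_apply (cadjoint T) y)"
    and cadjoint_in_bounded_operators: "cadjoint T \<in> bounded_operators"
proof -
  obtain S where S: "S \<in> bounded_operators"
    "\<And>x y. cinner (blinfun_apply T x) y = cinner x (blinfun_apply S y)"
    using cadjoint_exists[OF assms] by (elim bexE) simp
  have "cadjoint T = S"
    unfolding cadjoint_def
  proof (rule the_equality)
    fix R assume "\<forall>x y. cinner (blinfun_apply T x) y = cinner x (blinfun_apply R y)"
    then have "cinner x (blinfun_apply R y) = cinner x (blinfun_apply S y)" for x y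
      by (metis S(2))
    then show "R = S" by (meson blinfun_eqI cinner_ext)
  qed (simp add: S(2))
  then show "cinner (blinfun_apply T x) y = cinner x (blinfun_apply (cadjoint T) y)"
    and "cadjoint T \<in> bounded_operators" using S by (simp_all only:)
qed

end

theory Submission
  imports Defs
begin

text \<open>
  In the scalar case \<open>\<Phi> = (M + \<mu> M') / 2\<close> with \<open>M' x = M (- x)\<close>, the function
  \<open>N = (M - \<mu> M') / 2\<close> plays the part of a sine for the cosine \<open>\<Phi>\<close>, and \<open>M = \<Phi> + N\<close>.  The
  products of its values are determined by \<open>\<Phi>\<close>: they are
  \<open>N x N y = D x y\<close>, where \<open>D x y = \<Phi> (x + y) - \<Phi> x \<Phi> y\<close>.  The operator
  theorem is proved by constructing bounded operators \<open>N x\<close> that satisfy this equation, the addition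
  law \<open>N (x + y) = \<Phi> x N y + N x \<Phi> y\<close> and \<open>N x + \<mu> x N (- x) = 0\<close>; these three laws say exactly
  what is needed to make \<open>M = \<Phi> + N\<close> multiplicative and \<open>\<Phi>\<close> the mean of \<open>M\<close> and \<open>\<mu> M'\<close>.

  The operators \<open>\<Phi> x\<close> commute, and \<open>\<Phi> x\<close> is the adjoint of a multiple of itself.  Hence
  everything lives in a commutative algebra of normal operators, and one could imagine working
  pointwise on its spectrum.  There, \<open>N\<close> is determined by the choice of one square root
  \<open>N g\<close> of some \<open>D g g \<noteq> 0\<close>, as \<open>N x = D x g / N g\<close>.  The difficulty is to choose the signs
  over the whole spectrum, since no single \<open>g\<close> need work everywhere.

  The proof replaces points of the spectrum by vectors.  Given a vector \<open>z\<close> with \<open>D g g z \<noteq> 0\<close>, an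
  operator square root of \<open>D g g\<close> is constructed on a part of the space that \<open>z\<close> meets
  (\<open>local_square_root\<close>).  The roots come from an iteration that converges in norm
  (\<open>square_root_exists\<close>).  The quotient \<open>D x g / N g\<close> becomes a
  factorization of one operator through another (\<open>bounded_factorization\<close>), and the laws of a sine
  hold at a vector \<open>T z \<noteq> 0\<close> (\<open>local_sine\<close>).  The local solutions commute with everything that
  commutes with \<open>\<Phi>\<close>, so they can be added up orthogonally: Zorn's lemma, applied to partially
  defined sine functions, yields one with dense domain (\<open>partial_sine_extend\<close>, \<open>global_sine\<close>).

  Each construction respects the bound \<open>\<parallel>N x\<parallel>\<^sup>2 \<le> \<parallel>D x x\<parallel>\<close>.  It is stable under orthogonal sums, so it
  makes the glued operators bounded; and as \<open>D x x\<close> tends to \<open>D 0 0 = 0\<close> for \<open>x\<close> tending to \<open>0\<close>, it also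
  gives the norm continuity of \<open>M\<close>.
\<close>

section \<open>Complex Hilbert spaces\<close>

text \<open>
  This makes the space of bounded operators complete in the operator norm, which the
  construction of square roots relies on.
\<close>

instance chilbert_space \<subseteq> banach ..

lemma cinner_zero_left [simp]: "cinner 0 y = 0" for y :: "'a::complex_inner"
  using cinner_diff_left[of y y y] by simp

lemma cinner_zero_right [simp]: "cinner x 0 = 0" for x :: "'a::complex_inner"
  using cinner_diff_right[of x x x] by simp

lemma scaleC_one [simp]: "1 *\<^sub>C x = x" for x :: "'a::complex_vector"
  using scaleR_scaleC[of 1 x] by simp

lemma scaleC_zero_right [simp]: "a *\<^sub>C (0 :: 'a::complex_normed_vector) = 0"
  using linear_0[OF bounded_linear.linear[OF bounded_linear_scaleC]] .

lemma scaleC_diff_right: "a *\<^sub>C (x - y) = a *\<^sub>C x - a *\<^sub>C y"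
  for x y :: "'a::complex_normed_vector"
  using linear_diff[OF bounded_linear.linear[OF bounded_linear_scaleC]] .

lemma scaleC_minus_right: "a *\<^sub>C (- x) = - (a *\<^sub>C x)" for x :: "'a::complex_normed_vector"
  using scaleC_diff_right[of a 0 x] by simp

lemma scaleC_minus_left: "(- a) *\<^sub>C x = - (a *\<^sub>C x)" for x :: "'a::complex_normed_vector"
  using scaleC_scaleC[of a "-1" x] scaleR_scaleC[of "-1" x] scaleC_minus_right[of a x] by simp

lemma scaleC_scaleR: "a *\<^sub>C (r *\<^sub>R x) = r *\<^sub>R (a *\<^sub>C x)" for x :: "'a::complex_vector"
  by (simp add: scaleR_scaleC scaleC_scaleC mult.commute)

lemma cinner_self: "cinner x x = of_real ((norm x)\<^sup>2)" for x :: "'a::complex_inner"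
proof (rule complex_eqI)
  show "Re (cinner x x) = Re (complex_of_real ((norm x)\<^sup>2))"
    by (simp add: power2_norm_eq_cinner)
  have "Im (cinner x x) = - Im (cinner x x)"
    using arg_cong[OF cinner_commute[of x x], of Im] by simp
  then show "Im (cinner x x) = Im (complex_of_real ((norm x)\<^sup>2))" by simp
qed

lemma cmod_cinner_le: "cmod (cinner x y) \<le> norm x * norm y" for x y :: "'a::complex_inner"
proof (cases "cinner x y = 0")
  case False
  define a where "a = cnj (cinner x y) / cmod (cinner x y)"
  have "cinner (a *\<^sub>C x) y = cmod (cinner x y)"
    using False complex_norm_square[of "cinner x y"]
    by (simp add: a_def cinner_scaleC_left field_simps power2_eq_square)
  moreover have "cmod a = 1" using False by (simp add: a_def norm_divide)
  ultimately show ?thesis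
    using Re_cinner_le[of "a *\<^sub>C x" y] by (simp add: norm_scaleC)
qed simp

lemma bounded_bilinear_cinner:
  "bounded_bilinear (cinner :: 'a::complex_inner \<Rightarrow> 'a \<Rightarrow> complex)"
proof
  show "\<exists>K. \<forall>a b::'a. norm (cinner a b) \<le> norm a * norm b * K"
    by (rule exI[of _ 1]) (simp add: cmod_cinner_le)
qed (simp_all add: cinner_add_left cinner_add_right cinner_scaleR_left cinner_scaleR_right
    scaleR_conv_of_real)

lemma norm_add_square_orth: "(norm (x + y))\<^sup>2 = (norm x)\<^sup>2 + (norm y)\<^sup>2"
  if "cinner x y = 0" for x y :: "'a::complex_inner"
  using that by (simp add: norm_add_square)

definition csubspace :: "'a::complex_vector set \<Rightarrow> bool"
  where "csubspace V \<longleftrightarrow>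
    0 \<in> V \<and> (\<forall>u\<in>V. \<forall>v\<in>V. u + v \<in> V) \<and> (\<forall>a. \<forall>u\<in>V. a *\<^sub>C u \<in> V)"

lemma cinner_eq_zero_if_minimal:
  fixes h y :: "'a::complex_inner"
  assumes "\<And>a. norm h \<le> norm (h - a *\<^sub>C y)"
  shows "cinner h y = 0"
proof -
  have Re0: "Re (cinner h k) = 0" if k: "\<And>t::real. norm h \<le> norm (h - t *\<^sub>R k)" for k
  proof -
    define r where "r = Re (cinner h k)"
    define t where "t = r / ((norm k)\<^sup>2 + 1)"
    have pos: "0 < (norm k)\<^sup>2 + 1" by (simp add: add_nonneg_pos)
    have "(norm h)\<^sup>2 \<le> (norm (h - t *\<^sub>R k))\<^sup>2" by (simp add: k power_mono)
    then have "2 * t * r \<le> t\<^sup>2 * (norm k)\<^sup>2"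
      by (simp add: norm_diff_square cinner_scaleR_right r_def power_mult_distrib)
    also have "\<dots> \<le> t\<^sup>2 * ((norm k)\<^sup>2 + 1)" by (simp add: mult_left_mono)
    also have "\<dots> = t * r" using pos by (simp add: t_def power2_eq_square)
    finally have "t * r \<le> 0" by (simp add: mult.commute)
    moreover have "t * r = r\<^sup>2 / ((norm k)\<^sup>2 + 1)" by (simp add: t_def power2_eq_square)
    ultimately have "r\<^sup>2 \<le> 0" using pos by (simp add: divide_le_0_iff)
    then show ?thesis by (simp add: r_def)
  qed
  show ?thesis
  proof (rule complex_eqI)
    show "Re (cinner h y) = Re 0"
      using Re0[of y] assms by (simp add: scaleR_scaleC)
    show "Im (cinner h y) = Im 0"
      using Re0[of "\<i> *\<^sub>C y"] assms
      by (simp add: scaleR_scaleC scaleC_scaleC cinner_scaleC_right)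
  qed
qed

text \<open>
  A minimizing sequence for the distance from \<open>u\<close> to \<open>V\<close> is Cauchy by the parallelogram
  identity.  As \<open>V\<close> is not assumed to be closed, the limit \<open>p\<close> lies only in its closure; the
  sequence itself is part of the conclusion because maps defined on \<open>V\<close> are later extended along it.
\<close>

lemma nearest_point:
  fixes V :: "'a::chilbert_space set"
  assumes V: "csubspace V"
  obtains v :: "nat \<Rightarrow> 'a" and p where "\<And>n. v n \<in> V" "v \<longlonglongrightarrow> p"
    "\<And>y. y \<in> V \<Longrightarrow> cinner (u - p) y = 0"
proof -
  have V0: "0 \<in> V" and Vadd: "\<And>a b. a \<in> V \<Longrightarrow> b \<in> V \<Longrightarrow> a + b \<in> V"
    and Vsc: "\<And>c a. a \<in> V \<Longrightarrow> c *\<^sub>C a \<in> V"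
    using V by (auto simp: csubspace_def)
  define d where "d = (INF v\<in>V. (norm (u - v))\<^sup>2)"
  have bdd: "bdd_below ((\<lambda>v. (norm (u - v))\<^sup>2) ` V)"
    by (rule bdd_belowI2[of _ 0]) simp
  have d_le: "d \<le> (norm (u - v))\<^sup>2" if "v \<in> V" for v
    unfolding d_def by (rule cINF_lower[OF bdd that])
  have "\<exists>v\<in>V. (norm (u - v))\<^sup>2 < d + e" if "e > 0" for e
    using cINF_less_iff[OF _ bdd, of "d + e"] that V0 by (auto simp: d_def)
  then have "\<exists>v. v \<in> V \<and> (norm (u - v))\<^sup>2 < d + 1 / real (Suc n)" for n
    by (metis of_nat_0_less_iff zero_less_Suc zero_less_divide_1_iff)
  then obtain v where v: "\<And>n. v n \<in> V" "\<And>n. (norm (u - v n))\<^sup>2 < d + 1 / real (Suc n)"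
    by metis
  have close: "(norm (a - b))\<^sup>2 \<le> 2 * ((norm (u - a))\<^sup>2 - d) + 2 * ((norm (u - b))\<^sup>2 - d)"
    if "a \<in> V" "b \<in> V" for a b
  proof -
    have "(1/2) *\<^sub>R (a + b) \<in> V" using that by (simp add: scaleR_scaleC Vadd Vsc)
    then have "4 * d \<le> 4 * (norm (u - (1/2) *\<^sub>R (a + b)))\<^sup>2" by (simp add: d_le)
    also have "\<dots> = (norm (2 *\<^sub>R (u - (1/2) *\<^sub>R (a + b))))\<^sup>2" by (simp add: power_mult_distrib)
    also have "2 *\<^sub>R (u - (1/2) *\<^sub>R (a + b)) = (u - a) + (u - b)"
      by (simp add: algebra_simps scaleR_2)
    finally show ?thesis
      using norm_add_square[of "u - a" "u - b"] norm_diff_square[of "u - a" "u - b"]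
      by (simp add: norm_minus_commute)
  qed
  have "Cauchy v"
  proof (rule CauchyI)
    fix e :: real assume "0 < e"
    then obtain N where N: "inverse (real (Suc N)) < e\<^sup>2 / 4"
      using reals_Archimedean[of "e\<^sup>2 / 4"] by auto
    have small: "(norm (u - v k))\<^sup>2 - d < e\<^sup>2 / 4" if "k \<ge> N" for k
    proof -
      have "1 / real (Suc k) \<le> inverse (real (Suc N))"
        using that by (simp add: inverse_eq_divide frac_le)
      with v(2)[of k] N show ?thesis by linarith
    qed
    have "norm (v m - v n) < e" if "m \<ge> N" "n \<ge> N" for m n
    proof -
      have "(norm (v m - v n))\<^sup>2 < e\<^sup>2"
        using close[OF v(1) v(1), of m n] small[OF that(1)] small[OF that(2)]
        by (simp add: field_simps)
      then show ?thesis using \<open>0 < e\<close> by (simp add: power2_less_imp_less)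
    qed
    then show "\<exists>M. \<forall>m\<ge>M. \<forall>n\<ge>M. norm (v m - v n) < e" by blast
  qed
  then obtain p where p: "v \<longlonglongrightarrow> p"
    using Cauchy_convergent convergent_def by blast
  have "(\<lambda>n. (norm (u - v n))\<^sup>2) \<longlonglongrightarrow> (norm (u - p))\<^sup>2" by (intro tendsto_intros p)
  moreover have "(\<lambda>n. d + 1 / real (Suc n)) \<longlonglongrightarrow> d + 0"
    by (intro tendsto_add tendsto_const LIMSEQ_Suc lim_1_over_n)
  ultimately have upper: "(norm (u - p))\<^sup>2 \<le> d + 0"
    by (rule LIMSEQ_le) (use v in \<open>auto intro: less_imp_le\<close>)
  have orth: "cinner (u - p) y = 0" if "y \<in> V" for y
  proof (rule cinner_eq_zero_if_minimal)
    fix a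
    have "(\<lambda>n. (norm (u - (v n + a *\<^sub>C y)))\<^sup>2) \<longlonglongrightarrow> (norm (u - (p + a *\<^sub>C y)))\<^sup>2"
      by (intro tendsto_intros p)
    then have "d \<le> (norm (u - (p + a *\<^sub>C y)))\<^sup>2"
      by (rule LIMSEQ_le_const) (use v(1) that in \<open>auto intro!: d_le Vadd Vsc\<close>)
    with upper have "(norm (u - p))\<^sup>2 \<le> (norm (u - p - a *\<^sub>C y))\<^sup>2"
      unfolding diff_diff_eq by linarith
    then show "norm (u - p) \<le> norm (u - p - a *\<^sub>C y)"
      using norm_ge_zero power2_le_imp_le by blast
  qed
  show ?thesis using that[OF v(1) p orth] .
qed

text \<open>
  Every vector is a limit of elements of \<open>V\<close> plus a vector orthogonal to \<open>V\<close>.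
\<close>

lemma blinfun_eq_on_subspace_and_complement:
  fixes S T :: "'a::chilbert_space \<Rightarrow>\<^sub>L 'b::real_normed_vector"
  assumes "csubspace V" and onV: "\<And>v. v \<in> V \<Longrightarrow> S v = T v"
    and onC: "\<And>z. (\<And>v. v \<in> V \<Longrightarrow> cinner z v = 0) \<Longrightarrow> S z = T z"
  shows "S = T"
proof (rule blinfun_eqI)
  fix u
  obtain v p where v: "\<And>n. v n \<in> V" "v \<longlonglongrightarrow> p" "\<And>y. y \<in> V \<Longrightarrow> cinner (u - p) y = 0"
    using nearest_point[OF assms(1), where u = u] by blast
  have "(\<lambda>n. S (v n)) \<longlonglongrightarrow> S p" "(\<lambda>n. T (v n)) \<longlonglongrightarrow> T p"
    by (intro tendsto_intros v(2))+
  then have "S p = T p" using LIMSEQ_unique by (simp add: onV v(1))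
  moreover have "S (u - p) = T (u - p)" by (rule onC[OF v(3)])
  ultimately show "S u = T u" by (simp add: blinfun.diff_right)
qed

text \<open>
  Partially defined linear maps are handled as relations.  Only linearity is recorded here:
  single-valuedness will follow from a norm bound.
\<close>

definition clinear_graph :: "('a::complex_vector \<times> 'b::complex_vector) set \<Rightarrow> bool"
  where "clinear_graph \<Gamma> \<longleftrightarrow> (0, 0) \<in> \<Gamma> \<and>
    (\<forall>u w u' w'. (u, w) \<in> \<Gamma> \<longrightarrow> (u', w') \<in> \<Gamma> \<longrightarrow> (u + u', w + w') \<in> \<Gamma>) \<and>
    (\<forall>a u w. (u, w) \<in> \<Gamma> \<longrightarrow> (a *\<^sub>C u, a *\<^sub>C w) \<in> \<Gamma>)"

lemma clinear_graphI:
  assumes "(0, 0) \<in> \<Gamma>"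
    and "\<And>u w u' w'. (u, w) \<in> \<Gamma> \<Longrightarrow> (u', w') \<in> \<Gamma> \<Longrightarrow> (u + u', w + w') \<in> \<Gamma>"
    and "\<And>a u w. (u, w) \<in> \<Gamma> \<Longrightarrow> (a *\<^sub>C u, a *\<^sub>C w) \<in> \<Gamma>"
  shows "clinear_graph \<Gamma>"
  using assms by (auto simp: clinear_graph_def)

lemma csubspace_Domain: "clinear_graph \<Gamma> \<Longrightarrow> csubspace (Domain \<Gamma>)"
  unfolding csubspace_def clinear_graph_def by (blast elim: DomainE)

lemma clinear_graph_diff:
  assumes "clinear_graph \<Gamma>" "(u, w) \<in> \<Gamma>" "(u', w') \<in> \<Gamma>"
  shows "(u - u', w - w') \<in> \<Gamma>"
proof -
  have "((-1) *\<^sub>C u', (-1) *\<^sub>C w') \<in> \<Gamma>" using assms by (auto simp: clinear_graph_def)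
  then have "(- u', - w') \<in> \<Gamma>"
    using scaleR_scaleC[of "-1" u'] scaleR_scaleC[of "-1" w'] by simp
  then have "(u + - u', w + - w') \<in> \<Gamma>" using assms unfolding clinear_graph_def by blast
  then show ?thesis by simp
qed

text \<open>
  Follow a sequence in the domain that approaches the projection of \<open>u\<close>: its images are Cauchy
  because of the bound, and their limit is the value at \<open>u\<close>.  The relation \<open>E\<close> collects all such limits.
  It is again linear with the same bound, and the bound alone makes it single-valued, so no
  choice of sequences has to be made compatible.
\<close>

lemma bounded_graph_extension:
  fixes \<Gamma> :: "('a::chilbert_space \<times> 'a) set"
  assumes lin: "clinear_graph \<Gamma>"
    and bound: "\<And>u w. (u, w) \<in> \<Gamma> \<Longrightarrow> norm w \<le> C * norm u" and "0 \<le> C"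
  obtains F where "F \<in> bounded_operators" "norm F \<le> C" "\<And>u w. (u, w) \<in> \<Gamma> \<Longrightarrow> F u = w"
    "\<And>z. (\<And>u w. (u, w) \<in> \<Gamma> \<Longrightarrow> cinner z u = 0) \<Longrightarrow> F z = 0"
proof -
  define E where "E = {(u, w). \<exists>v f p. (\<forall>n. (v n, f n) \<in> \<Gamma>) \<and> v \<longlonglongrightarrow> p \<and> f \<longlonglongrightarrow> w \<and>
    (\<forall>y\<in>Domain \<Gamma>. cinner (u - p) y = 0)}"
  have EI: "(u, w) \<in> E" if "\<And>n. (v n, f n) \<in> \<Gamma>" "v \<longlonglongrightarrow> p" "f \<longlonglongrightarrow> w"
    "\<And>y. y \<in> Domain \<Gamma> \<Longrightarrow> cinner (u - p) y = 0" for u w v f p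
    using that unfolding E_def by blast
  have total: "\<exists>w. (u, w) \<in> E" for u
  proof -
    obtain v p where v: "\<And>n. v n \<in> Domain \<Gamma>" "v \<longlonglongrightarrow> p"
      "\<And>y. y \<in> Domain \<Gamma> \<Longrightarrow> cinner (u - p) y = 0"
      using nearest_point[OF csubspace_Domain[OF lin], where u = u] by blast
    then have "\<forall>n. \<exists>w. (v n, w) \<in> \<Gamma>" by blast
    then obtain f where f: "\<And>n. (v n, f n) \<in> \<Gamma>" by metis
    have "Cauchy f"
    proof (rule CauchyI)
      fix e :: real assume "0 < e"
      then have "0 < e / (C + 1)" using \<open>0 \<le> C\<close> by simp
      then obtain N where N: "\<And>m n. m \<ge> N \<Longrightarrow> n \<ge> N \<Longrightarrow> norm (v m - v n) < e / (C + 1)"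
        using CauchyD[OF LIMSEQ_imp_Cauchy[OF v(2)]] by blast
      have "norm (f m - f n) < e" if "m \<ge> N" "n \<ge> N" for m n
      proof -
        have "norm (f m - f n) \<le> C * norm (v m - v n)"
          by (rule bound[OF clinear_graph_diff[OF lin f f]])
        also have "\<dots> \<le> (C + 1) * norm (v m - v n)" by (simp add: mult_right_mono)
        also have "\<dots> < e" using N[OF that] \<open>0 \<le> C\<close> by (simp add: field_simps)
        finally show ?thesis .
      qed
      then show "\<exists>M. \<forall>m\<ge>M. \<forall>n\<ge>M. norm (f m - f n) < e" by blast
    qed
    then obtain w where "f \<longlonglongrightarrow> w" using Cauchy_convergent convergent_def by blast
    with f v show ?thesis by (blast intro: EI)
  qed
  have Ebound: "norm w \<le> C * norm u" if E: "(u, w) \<in> E" for u w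
  proof -
    obtain v f p where vf: "\<And>n. (v n, f n) \<in> \<Gamma>" "v \<longlonglongrightarrow> p" "f \<longlonglongrightarrow> w"
      and orth: "\<And>y. y \<in> Domain \<Gamma> \<Longrightarrow> cinner (u - p) y = 0"
      using E unfolding E_def by blast
    have "(\<lambda>n. C * norm (v n)) \<longlonglongrightarrow> C * norm p" by (intro tendsto_intros vf(2))
    then have w: "norm w \<le> C * norm p"
      by (rule LIMSEQ_le[OF tendsto_norm[OF vf(3)]]) (use bound vf(1) in auto)
    have "(\<lambda>n. cinner (u - p) (v n)) \<longlonglongrightarrow> cinner (u - p) p"
      by (intro bounded_bilinear.tendsto[OF bounded_bilinear_cinner] tendsto_const vf(2))
    moreover have "cinner (u - p) (v n) = 0" for n using orth vf(1) by blast
    ultimately have "cinner (u - p) p = 0" by (simp add: LIMSEQ_const_iff)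
    then have "(norm u)\<^sup>2 = (norm (u - p))\<^sup>2 + (norm p)\<^sup>2"
      using norm_add_square_orth[of "u - p" p] by simp
    then have "norm p \<le> norm u" using power2_le_imp_le[of "norm p" "norm u"] by simp
    then show ?thesis using w mult_left_mono[OF _ \<open>0 \<le> C\<close>, of "norm p" "norm u"] by simp
  qed
  have Elin: "clinear_graph E"
  proof (rule clinear_graphI)
    have "(0, 0) \<in> \<Gamma>" using lin by (simp add: clinear_graph_def)
    then show "(0, 0) \<in> E" by (intro EI[of "\<lambda>_. 0" "\<lambda>_. 0" 0]) simp_all
  next
    fix u w u' w' assume "(u, w) \<in> E" "(u', w') \<in> E"
    then obtain v f p v' f' p' where
      *: "\<And>n. (v n, f n) \<in> \<Gamma>" "v \<longlonglongrightarrow> p" "f \<longlonglongrightarrow> w" "\<And>n. (v' n, f' n) \<in> \<Gamma>" "v' \<longlonglongrightarrow> p'" "f' \<longlonglongrightarrow> w'"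
      and orth: "\<And>y. y \<in> Domain \<Gamma> \<Longrightarrow> cinner (u - p) y = 0"
        "\<And>y. y \<in> Domain \<Gamma> \<Longrightarrow> cinner (u' - p') y = 0"
      unfolding E_def by blast
    show "(u + u', w + w') \<in> E"
    proof (rule EI)
      show "(v n + v' n, f n + f' n) \<in> \<Gamma>" for n using lin * by (auto simp: clinear_graph_def)
      show "(\<lambda>n. v n + v' n) \<longlonglongrightarrow> p + p'" "(\<lambda>n. f n + f' n) \<longlonglongrightarrow> w + w'"
        by (intro tendsto_intros *)+
      show "cinner (u + u' - (p + p')) y = 0" if "y \<in> Domain \<Gamma>" for y
        using orth[OF that] by (simp add: cinner_diff_left cinner_add_left)
    qed
  next
    fix a u w assume "(u, w) \<in> E"
    then obtain v f p where
      *: "\<And>n. (v n, f n) \<in> \<Gamma>" "v \<longlonglongrightarrow> p" "f \<longlonglongrightarrow> w"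
      and orth: "\<And>y. y \<in> Domain \<Gamma> \<Longrightarrow> cinner (u - p) y = 0"
      unfolding E_def by blast
    show "(a *\<^sub>C u, a *\<^sub>C w) \<in> E"
    proof (rule EI)
      show "(a *\<^sub>C v n, a *\<^sub>C f n) \<in> \<Gamma>" for n using lin * by (auto simp: clinear_graph_def)
      show "(\<lambda>n. a *\<^sub>C v n) \<longlonglongrightarrow> a *\<^sub>C p" "(\<lambda>n. a *\<^sub>C f n) \<longlonglongrightarrow> a *\<^sub>C w"
        by (intro bounded_linear.tendsto[OF bounded_linear_scaleC] *)+
      show "cinner (a *\<^sub>C u - a *\<^sub>C p) y = 0" if "y \<in> Domain \<Gamma>" for y
        using orth[OF that] by (simp add: cinner_diff_left cinner_scaleC_left)
    qed
  qed
  have unique: "w = w'" if "(u, w) \<in> E" "(u, w') \<in> E" for u w w'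
    using Ebound[OF clinear_graph_diff[OF Elin that]] by simp
  obtain F where F: "\<And>u. (u, F u) \<in> E" using total by metis
  have F_eq: "F u = w" if "(u, w) \<in> E" for u w using unique[OF F that] .
  have F_add: "F (u + v) = F u + F v" for u v
    using F[of u] F[of v] Elin by (intro F_eq) (simp add: clinear_graph_def)
  have F_scale: "F (a *\<^sub>C u) = a *\<^sub>C F u" for a u
    using F[of u] Elin by (intro F_eq) (simp add: clinear_graph_def)
  have bl: "bounded_linear F"
    by (rule bounded_linear_intro[where K = C])
      (simp_all add: F_add F_scale scaleR_scaleC Ebound[OF F] mult.commute[of _ C])
  note [simp] = bounded_linear_Blinfun_apply[OF bl]
  show ?thesis
  proof (rule that[of "Blinfun F"])
    show "Blinfun F \<in> bounded_operators" by (simp add: bounded_operators_def F_scale)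
    show "norm (Blinfun F) \<le> C" by (rule norm_blinfun_bound) (simp_all add: \<open>0 \<le> C\<close> Ebound[OF F])
    show "Blinfun F u = w" if "(u, w) \<in> \<Gamma>" for u w
      using that by (auto intro!: F_eq EI[of "\<lambda>_. u" "\<lambda>_. w" u])
    show "Blinfun F z = 0" if "\<And>u w. (u, w) \<in> \<Gamma> \<Longrightarrow> cinner z u = 0" for z
    proof -
      have "(0, 0) \<in> \<Gamma>" using lin by (simp add: clinear_graph_def)
      then have "(z, 0) \<in> E" using that by (intro EI[of "\<lambda>_. 0" "\<lambda>_. 0" 0]) auto
      then show ?thesis by (simp add: F_eq)
    qed
  qed
qed

section \<open>Square roots of operators\<close>

lemma tendsto_blinfun_compose:
  fixes X Y :: "nat \<Rightarrow> 'a::real_normed_vector \<Rightarrow>\<^sub>L 'a"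
  shows "X \<longlonglongrightarrow> A \<Longrightarrow> Y \<longlonglongrightarrow> B \<Longrightarrow> (\<lambda>n. X n o\<^sub>L Y n) \<longlonglongrightarrow> (A o\<^sub>L B)"
  by (rule bounded_bilinear.tendsto[OF bounded_bilinear_blinfun_compose])

text \<open>
  For an operator \<open>R\<close> of norm at most 1, a solution of \<open>Y = (R + Y\<^sup>2) / 2\<close> gives a square root
  \<open>1 - Y\<close> of \<open>1 - R\<close>.
\<close>

fun sqrt_iterate :: "('a::real_normed_vector \<Rightarrow>\<^sub>L 'a) \<Rightarrow> nat \<Rightarrow> 'a \<Rightarrow>\<^sub>L 'a" where
  "sqrt_iterate R 0 = 0"
| "sqrt_iterate R (Suc n) = (1 / 2) *\<^sub>R (R + (sqrt_iterate R n o\<^sub>L sqrt_iterate R n))"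

text \<open>
  The same iteration for the scalar 1.  It increases and is bounded by 1, and it dominates the operator
  iteration together with its increments, which is why the latter converges in norm even in the
  extreme case \<open>\<parallel>R\<parallel> = 1\<close>.
\<close>

fun sqrt_majorant :: "nat \<Rightarrow> real" where
  "sqrt_majorant 0 = 0"
| "sqrt_majorant (Suc n) = (1 + (sqrt_majorant n)\<^sup>2) / 2"

lemma sqrt_iterate_commute:
  "C o\<^sub>L R = R o\<^sub>L C \<Longrightarrow> C o\<^sub>L sqrt_iterate R n = sqrt_iterate R n o\<^sub>L C"
proof (induction n)
  case (Suc n)
  let ?Y = "sqrt_iterate R n"
  have "C (R u) = R (C u)" "C (?Y u) = ?Y (C u)" for u
    using Suc by (metis blinfun_apply_blinfun_compose)+
  then show ?case
    by (intro blinfun_eqI) (simp add: blinfun.bilinear_simps)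
qed (auto intro!: blinfun_eqI simp: blinfun.bilinear_simps)

lemma sqrt_majorant_bounds: "0 \<le> sqrt_majorant n \<and> sqrt_majorant n \<le> 1"
proof (induction n)
  case (Suc n)
  then have "(sqrt_majorant n)\<^sup>2 \<le> 1" by (simp add: power_le_one)
  then show ?case by simp
qed simp

text \<open>
  Consecutive iterates commute, so \<open>Y\<^sup>2 - X\<^sup>2 = (Y - X) (Y + X)\<close>, and the same formula for the
  scalar iteration turns the bounds at one step into those at the next.
\<close>

lemma sqrt_iterate_bounds:
  assumes "norm R \<le> 1"
  shows "norm (sqrt_iterate R n) \<le> sqrt_majorant n"
    and "norm (sqrt_iterate R (Suc n) - sqrt_iterate R n) \<le> sqrt_majorant (Suc n) - sqrt_majorant n"
proof -
  show bound: "norm (sqrt_iterate R n) \<le> sqrt_majorant n" for n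
  proof (induction n)
    case (Suc n)
    let ?Y = "sqrt_iterate R n"
    have "norm (?Y o\<^sub>L ?Y) \<le> norm ?Y * norm ?Y" by (rule norm_blinfun_compose)
    also have "\<dots> \<le> (sqrt_majorant n)\<^sup>2"
      using Suc by (simp add: power2_eq_square mult_mono sqrt_majorant_bounds)
    finally have "norm (R + (?Y o\<^sub>L ?Y)) \<le> 1 + (sqrt_majorant n)\<^sup>2"
      using assms norm_triangle_ineq[of R "?Y o\<^sub>L ?Y"] by linarith
    then show ?case by simp
  qed simp
  show "norm (sqrt_iterate R (Suc n) - sqrt_iterate R n) \<le> sqrt_majorant (Suc n) - sqrt_majorant n"
  proof (induction n)
    case 0
    then show ?case using assms by simp
  next
    case (Suc n)
    let ?X = "sqrt_iterate R n" and ?Y = "sqrt_iterate R (Suc n)"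
    let ?x = "sqrt_majorant n" and ?y = "sqrt_majorant (Suc n)"
    have "?X o\<^sub>L ?Y = ?Y o\<^sub>L ?X"
      by (intro sqrt_iterate_commute sqrt_iterate_commute[symmetric] refl)
    then have comm: "?X (?Y u) = ?Y (?X u)" for u by (metis blinfun_apply_blinfun_compose)
    have "sqrt_iterate R (Suc (Suc n)) - ?Y = (1 / 2) *\<^sub>R ((?Y o\<^sub>L ?Y) - (?X o\<^sub>L ?X))"
      by (subst (1 2) sqrt_iterate.simps(2)) (simp add: algebra_simps del: sqrt_iterate.simps)
    also have "(?Y o\<^sub>L ?Y) - (?X o\<^sub>L ?X) = (?Y - ?X) o\<^sub>L (?Y + ?X)"
      by (rule blinfun_eqI) (simp add: blinfun.bilinear_simps comm del: sqrt_iterate.simps)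
    finally have "norm (sqrt_iterate R (Suc (Suc n)) - ?Y) = norm ((?Y - ?X) o\<^sub>L (?Y + ?X)) / 2"
      by (simp del: sqrt_iterate.simps)
    also have "\<dots> \<le> norm (?Y - ?X) * norm (?Y + ?X) / 2"
      by (intro divide_right_mono norm_blinfun_compose) simp
    also have "\<dots> \<le> (?y - ?x) * (?y + ?x) / 2"
    proof (intro divide_right_mono mult_mono Suc)
      show "norm (?Y + ?X) \<le> ?y + ?x"
        by (rule order_trans[OF norm_triangle_ineq]) (intro add_mono bound)
      show "0 \<le> ?y - ?x" using order_trans[OF norm_ge_zero Suc] .
    qed simp_all
    also have "\<dots> = sqrt_majorant (Suc (Suc n)) - ?y"
      by (subst (3) sqrt_majorant.simps(2), subst (4) sqrt_majorant.simps(2))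
        (simp add: power2_eq_square field_simps del: sqrt_majorant.simps)
    finally show ?case .
  qed
qed

lemma convergent_sqrt_iterate:
  fixes R :: "'a::chilbert_space \<Rightarrow>\<^sub>L 'a"
  assumes "norm R \<le> 1"
  shows "convergent (sqrt_iterate R)"
proof -
  have diff: "norm (sqrt_iterate R (n + k) - sqrt_iterate R n) \<le> sqrt_majorant (n + k) - sqrt_majorant n"
    for n k
  proof (induction k)
    case (Suc k)
    then show ?case
      using norm_triangle_ineq[of "sqrt_iterate R (n + Suc k) - sqrt_iterate R (n + k)"
          "sqrt_iterate R (n + k) - sqrt_iterate R n"] sqrt_iterate_bounds(2)[OF assms, of "n + k"]
      by (simp del: sqrt_iterate.simps sqrt_majorant.simps)
  qed simp
  have "incseq sqrt_majorant"
    using order_trans[OF norm_ge_zero sqrt_iterate_bounds(2)[OF assms]]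
    by (intro incseq_SucI) (simp del: sqrt_majorant.simps)
  then have "convergent sqrt_majorant"
    using sqrt_majorant_bounds by (auto simp: convergent_def intro: incseq_convergent[of _ 1])
  then have "Cauchy sqrt_majorant" by (rule convergent_Cauchy)
  have "Cauchy (sqrt_iterate R)"
  proof (rule CauchyI')
    fix e :: real assume "0 < e"
    then obtain N where N: "\<And>m n. m \<ge> N \<Longrightarrow> n \<ge> N \<Longrightarrow> norm (sqrt_majorant m - sqrt_majorant n) < e"
      using CauchyD[OF \<open>Cauchy sqrt_majorant\<close>] by blast
    have "dist (sqrt_iterate R m) (sqrt_iterate R n) < e" if "m \<ge> N" "n > m" for m n
      using diff[of m "n - m"] N[of n m] that by (simp add: dist_norm norm_minus_commute)
    then show "\<exists>M. \<forall>m\<ge>M. \<forall>n>m. dist (sqrt_iterate R m) (sqrt_iterate R n) < e" by blast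
  qed
  then show ?thesis by (rule Cauchy_convergent)
qed

definition self_adjoint :: "('h::complex_inner \<Rightarrow>\<^sub>L 'h) \<Rightarrow> bool"
  where "self_adjoint T \<longleftrightarrow> (\<forall>u v. cinner (T u) v = cinner u (T v))"

text \<open>
  The limit \<open>Y\<close> of the iteration gives the root \<open>1 - Y\<close>, and \<open>\<parallel>Y\<parallel> \<le> 1\<close>.  So the root satisfies
  the same hypotheses as \<open>T\<close>, and a fourth root is available by applying the lemma
  twice; this is used in place of a theory of positive operators.
\<close>

lemma square_root_exists:
  fixes T :: "'a::chilbert_space \<Rightarrow>\<^sub>L 'a"
  assumes T: "T \<in> bounded_operators" "self_adjoint T" and near: "norm (id_blinfun - T) \<le> 1"
  obtains S where "S \<in> bounded_operators" "self_adjoint S" "norm (id_blinfun - S) \<le> 1"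
    "S o\<^sub>L S = T" "\<And>C. C o\<^sub>L T = T o\<^sub>L C \<Longrightarrow> C o\<^sub>L S = S o\<^sub>L C"
proof -
  define R where "R = id_blinfun - T"
  obtain Y where Y: "sqrt_iterate R \<longlonglongrightarrow> Y"
    using convergent_sqrt_iterate[of R] near by (auto simp: R_def convergent_def)
  define Z where "Z = R + (Y o\<^sub>L Y)"
  have "(\<lambda>n. sqrt_iterate R (Suc n)) \<longlonglongrightarrow> (1 / 2) *\<^sub>R Z"
    unfolding sqrt_iterate.simps Z_def by (intro tendsto_intros tendsto_blinfun_compose Y)
  then have half: "Y = (1 / 2) *\<^sub>R Z"
    using LIMSEQ_unique[OF LIMSEQ_Suc[OF Y]] by blast
  have "2 *\<^sub>R Y = Z" by (subst half) simp
  then have "Z u = 2 *\<^sub>R Y u" for u by (metis blinfun.scaleR_left)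
  then have fixpoint: "Y (Y u) = 2 *\<^sub>R Y u - R u" for u
    using eq_diff_eq[of "Y (Y u)" "2 *\<^sub>R Y u" "R u"]
    by (simp add: Z_def blinfun.add_left add.commute)
  have limit_apply: "(\<lambda>n. sqrt_iterate R n u) \<longlonglongrightarrow> Y u" for u by (intro tendsto_intros Y)
  have Yn_C: "sqrt_iterate R n (a *\<^sub>C u) = a *\<^sub>C sqrt_iterate R n u" for n a u
  proof (induction n arbitrary: u)
    case (Suc n)
    then show ?case
      using T(1)
      by (simp add: R_def bounded_operators_def blinfun.bilinear_simps scaleC_scaleR
          scaleC_add_right scaleC_diff_right)
  qed simp
  have Y_C: "Y (a *\<^sub>C u) = a *\<^sub>C Y u" for a u
  proof (rule LIMSEQ_unique[OF limit_apply])
    show "(\<lambda>n. sqrt_iterate R n (a *\<^sub>C u)) \<longlonglongrightarrow> a *\<^sub>C Y u"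
      unfolding Yn_C by (intro bounded_linear.tendsto[OF bounded_linear_scaleC] limit_apply)
  qed
  have Yn_sa: "cinner (sqrt_iterate R n u) v = cinner u (sqrt_iterate R n v)" for n u v
  proof (induction n arbitrary: u v)
    case (Suc n)
    then show ?case
      using T(2) by (simp add: R_def self_adjoint_def blinfun.bilinear_simps cinner_scaleR_left
          cinner_scaleR_right cinner_add_left cinner_add_right cinner_diff_left cinner_diff_right)
  qed simp
  have Y_sa: "cinner (Y u) v = cinner u (Y v)" for u v
  proof (rule LIMSEQ_unique)
    show "(\<lambda>n. cinner (sqrt_iterate R n u) v) \<longlonglongrightarrow> cinner (Y u) v"
      by (intro bounded_bilinear.tendsto[OF bounded_bilinear_cinner] tendsto_const limit_apply)
    show "(\<lambda>n. cinner (sqrt_iterate R n u) v) \<longlonglongrightarrow> cinner u (Y v)"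
      unfolding Yn_sa
      by (intro bounded_bilinear.tendsto[OF bounded_bilinear_cinner] tendsto_const limit_apply)
  qed
  show ?thesis
  proof (rule that[of "id_blinfun - Y"])
    show "id_blinfun - Y \<in> bounded_operators"
      by (simp add: bounded_operators_def blinfun.bilinear_simps Y_C
          scaleC_diff_right)
    show "self_adjoint (id_blinfun - Y)"
      by (simp add: self_adjoint_def blinfun.bilinear_simps cinner_diff_left cinner_diff_right Y_sa)
    have "norm (sqrt_iterate R n) \<le> 1" for n
      using sqrt_iterate_bounds(1)[of R n] sqrt_majorant_bounds[of n] near by (simp add: R_def)
    then have "norm Y \<le> 1" by (intro LIMSEQ_le_const2[OF tendsto_norm[OF Y]]) simp
    then show "norm (id_blinfun - (id_blinfun - Y)) \<le> 1" by simp
    show "(id_blinfun - Y) o\<^sub>L (id_blinfun - Y) = T"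
      by (rule blinfun_eqI)
        (simp add: blinfun.bilinear_simps fixpoint R_def algebra_simps scaleR_2)
    show "C o\<^sub>L (id_blinfun - Y) = (id_blinfun - Y) o\<^sub>L C" if "C o\<^sub>L T = T o\<^sub>L C" for C
    proof -
      have "C (T u) = T (C u)" for u using that by (metis blinfun_apply_blinfun_compose)
      then have "C o\<^sub>L R = R o\<^sub>L C"
        by (intro blinfun_eqI) (simp add: R_def blinfun.bilinear_simps)
      then have eq: "C o\<^sub>L sqrt_iterate R n = sqrt_iterate R n o\<^sub>L C" for n
        by (rule sqrt_iterate_commute)
      have "C o\<^sub>L Y = Y o\<^sub>L C"
      proof (rule LIMSEQ_unique)
        show "(\<lambda>n. C o\<^sub>L sqrt_iterate R n) \<longlonglongrightarrow> (C o\<^sub>L Y)"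
          by (intro tendsto_blinfun_compose tendsto_const Y)
        show "(\<lambda>n. C o\<^sub>L sqrt_iterate R n) \<longlonglongrightarrow> (Y o\<^sub>L C)"
          unfolding eq by (intro tendsto_blinfun_compose tendsto_const Y)
      qed
      then have "C (Y u) = Y (C u)" for u by (metis blinfun_apply_blinfun_compose)
      then show ?thesis by (intro blinfun_eqI) (simp add: blinfun.bilinear_simps)
    qed
  qed
qed

section \<open>The algebra of a hermitian cosine function\<close>

text \<open>
  Both parts compare \<open>\<langle>T w, T w\<rangle>\<close> with \<open>\<langle>T T w, w\<rangle>\<close> by moving one factor \<open>T\<close> across.  The first part
  lets \<open>T\<^sup>2\<close> control \<open>T\<close>, as it does for any normal operator.
\<close>

lemma norm_square_if_adjoint_multiple:
  fixes T :: "'a::complex_inner \<Rightarrow>\<^sub>L 'a"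
  assumes adj: "\<And>u v. cinner (T u) v = cinner u (c *\<^sub>C T v)"
  shows "(norm (T w))\<^sup>2 = cmod (cinner (T (T w)) w)" and "T w \<noteq> 0 \<Longrightarrow> cmod c = 1"
proof -
  let ?n = "(norm (T w))\<^sup>2"
  have 1: "cinner (T (T w)) w = cnj c * of_real ?n"
    by (simp add: adj[of "T w"] cinner_scaleC_right cinner_self)
  have "of_real ?n = cnj c * cinner w (T (T w))"
    using adj[of w "T w"] by (simp add: cinner_self cinner_scaleC_right)
  also have "cinner w (T (T w)) = c * of_real ?n"
    by (subst cinner_commute) (simp add: 1)
  finally have "complex_of_real ?n = of_real ((cmod c)\<^sup>2 * ?n)"
    using complex_norm_square[of c] by (simp add: mult.commute)
  then have 2: "?n = (cmod c)\<^sup>2 * ?n" unfolding of_real_eq_iff .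
  show 3: "cmod c = 1" if "T w \<noteq> 0"
    using 2 that power2_eq_1_iff[of "cmod c"] norm_ge_zero[of c] by auto
  show "?n = cmod (cinner (T (T w)) w)"
    using 3 by (cases "T w = 0") (simp_all add: 1 norm_mult norm_power)
qed

locale hermitian_cosine =
  fixes \<mu> :: "'g::topological_ab_group_add \<Rightarrow> complex"
    and \<Phi> :: "'g \<Rightarrow> 'h::chilbert_space \<Rightarrow>\<^sub>L 'h"
  assumes character: "continuous_character \<mu>"
    and cosine: "operator_cosine_function \<mu> \<Phi>"
    and herm: "hermitian \<Phi>"
begin

lemma mu_nonzero [simp]: "\<mu> x \<noteq> 0"
  using character by (simp add: continuous_character_def)

lemma mu_add: "\<mu> (x + y) = \<mu> x * \<mu> y"
  using character by (simp add: continuous_character_def)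

lemma mu_diff: "\<mu> (x - y) = \<mu> x / \<mu> y"
  using mu_add[of "x - y" y] by (simp add: field_simps)

lemma mu_zero [simp]: "\<mu> 0 = 1"
  using mu_diff[of 0 0] by simp

lemma Phi_bounded: "\<Phi> x \<in> bounded_operators"
  using cosine by (simp add: operator_cosine_function_def)

lemma Phi_scaleC: "\<Phi> x (a *\<^sub>C u) = a *\<^sub>C \<Phi> x u"
  using Phi_bounded[of x] by (simp add: bounded_operators_def)

lemma Phi_zero [simp]: "\<Phi> 0 = id_blinfun"
  using cosine by (simp add: operator_cosine_function_def)

lemma Phi_product: "2 *\<^sub>R \<Phi> x (\<Phi> y u) = \<Phi> (x + y) u + \<mu> y *\<^sub>C \<Phi> (x - y) u"
proof -
  have "\<Phi> (x + y) + \<mu> y *\<^sub>C \<Phi> (x - y) = 2 *\<^sub>R (\<Phi> x o\<^sub>L \<Phi> y)"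
    using cosine by (simp add: operator_cosine_function_def)
  then show ?thesis
    by (metis blinfun.add_left blinfun.scaleR_left blinfun_apply_blinfun_compose scaleC_blinfun.rep_eq)
qed

lemma Phi_reflect: "\<Phi> (- x) u = (1 / \<mu> x) *\<^sub>C \<Phi> x u"
proof -
  have "2 *\<^sub>R \<Phi> x u = \<Phi> x u + \<mu> x *\<^sub>C \<Phi> (- x) u" using Phi_product[of 0 x u] by simp
  then have "\<Phi> x u = \<mu> x *\<^sub>C \<Phi> (- x) u" by (simp add: scaleR_2)
  then show ?thesis by (simp add: scaleC_scaleC)
qed

lemma Phi_adjoint: "cinner (\<Phi> x u) v = cinner u (\<Phi> (- x) v)"
  using herm cinner_cadjoint[OF Phi_bounded] by (simp add: hermitian_def)

text \<open>
  Operator identities between the \<open>\<Phi> x\<close> are verified on the matrix coefficients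
  \<open>x \<mapsto> \<langle>\<Phi> x u, v\<rangle>\<close>, where they become identities between complex numbers.
\<close>

lemma coefficient_product:
  "cinner (\<Phi> x (\<Phi> y u)) v = (cinner (\<Phi> (x + y) u) v + \<mu> y * cinner (\<Phi> (x - y) u) v) / 2"
proof -
  have "2 * cinner (\<Phi> x (\<Phi> y u)) v = cinner (2 *\<^sub>R \<Phi> x (\<Phi> y u)) v"
    by (simp add: cinner_scaleR_left)
  also have "\<dots> = cinner (\<Phi> (x + y) u) v + \<mu> y * cinner (\<Phi> (x - y) u) v"
    by (simp only: Phi_product cinner_add_left cinner_scaleC_left)
  finally show ?thesis by (simp add: field_simps)
qed

lemma coefficient_reflect: "cinner (\<Phi> (y - x) u) v = \<mu> y / \<mu> x * cinner (\<Phi> (x - y) u) v"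
  using Phi_reflect[of "x - y" u] by (simp add: cinner_scaleC_left mu_diff)

lemma eq_if_coefficients_eq:
  fixes a b :: 'h
  assumes "\<And>v. cinner a v = cinner b v"
  shows "a = b"
  by (rule cinner_ext) (metis assms cinner_commute)

lemma Phi_commute: "\<Phi> x (\<Phi> y u) = \<Phi> y (\<Phi> x u)"
  by (rule eq_if_coefficients_eq)
    (simp add: coefficient_product coefficient_reflect[of y x] add.commute)

text \<open>
  The product \<open>N x N y\<close> of a sine function \<open>N\<close> belonging to \<open>\<Phi>\<close>.  In particular,
  \<open>D x x = \<Phi> x \<Phi> x - \<mu> x\<close> plays the part of a squared sine.
\<close>

definition D :: "'g \<Rightarrow> 'g \<Rightarrow> 'h \<Rightarrow>\<^sub>L 'h"
  where "D x y = \<Phi> (x + y) - (\<Phi> x o\<^sub>L \<Phi> y)"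

lemma D_apply: "D x y u = \<Phi> (x + y) u - \<Phi> x (\<Phi> y u)"
  by (simp add: D_def blinfun.bilinear_simps)

lemma D_sym: "D x y = D y x"
  by (rule blinfun_eqI) (simp add: D_apply Phi_commute add.commute)

lemma coefficient_D:
  "cinner (D x y u) v = (cinner (\<Phi> (x + y) u) v - \<mu> y * cinner (\<Phi> (x - y) u) v) / 2"
  by (simp add: D_apply cinner_diff_left coefficient_product field_simps)

lemma Phi_D_commute: "\<Phi> a (D x y u) = D x y (\<Phi> a u)"
  by (simp add: D_apply blinfun.bilinear_simps Phi_commute[of a])

lemma coefficient_Phi_D:
  "cinner (\<Phi> a (D x y u)) v = (cinner (\<Phi> a (\<Phi> (x + y) u)) v - \<mu> y * cinner (\<Phi> a (\<Phi> (x - y) u)) v) / 2"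
  unfolding Phi_D_commute coefficient_D
  by (simp add: Phi_commute[of _ a])

text \<open>
  The right-hand side is symmetric in \<open>y\<close>, \<open>z\<close> and \<open>w\<close>.  This is the algebraic
  reason why \<open>D x y\<close> can be a product \<open>N x N y\<close>.
\<close>

lemma coefficient_D_D:
  "cinner (D x y (D z w u)) v = (let f = (\<lambda>a. cinner (\<Phi> a u) v) in
    f (x + y + z + w) + \<mu> (z + w) * f (x + y - z - w)
    - \<mu> w * f (x + y + z - w) - \<mu> z * f (x + y - z + w) - \<mu> y * f (x - y + z + w)
    - \<mu> (y + z + w) * f (x - y - z - w) + \<mu> (y + w) * f (x - y + z - w)
    + \<mu> (y + z) * f (x - y - z + w)) / 8"
proof -
  have args: "a + (b + c) = a + b + c" "a - (b + c) = a - b - c" "a + (b - c) = a + b - c"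
    "a - (b - c) = a - b + c" for a b c :: 'g
    by (simp_all add: algebra_simps)
  show ?thesis
    unfolding coefficient_D[of x y] coefficient_Phi_D coefficient_product args Let_def mu_add mu_diff
    by (simp add: field_simps)
qed

lemma D_D_exchange: "D x y (D z w u) = D x z (D y w u)"
  by (rule eq_if_coefficients_eq)
   (simp add: coefficient_D_D Let_def algebra_simps mu_add)

lemma D_D_symmetric: "D x g (D y g u) = D x y (D g g u)"
  by (metis D_D_exchange D_sym)

text \<open>
  The addition law of the sine, multiplied by \<open>N g\<close>.  The next lemma is likewise
  \<open>N x + \<mu> x N (- x) = 0\<close> multiplied by \<open>N g\<close>.
\<close>

lemma D_add_left: "D (x + y) g u = \<Phi> x (D y g u) + D x g (\<Phi> y u)"
proof -
  have "D x g (\<Phi> y u) = \<Phi> y (D x g u)" by (simp add: Phi_D_commute)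
  moreover have "cinner (D (x + y) g u) v = cinner (\<Phi> x (D y g u)) v + cinner (\<Phi> y (D x g u)) v" for v
    unfolding coefficient_Phi_D coefficient_product coefficient_D
    using coefficient_reflect[of "g + y" x u v] coefficient_reflect[of "g + x" y u v]
    by (simp add: mu_add mu_diff add_diff_eq diff_diff_eq2 add.commute add.left_commute) (simp add: field_simps)
  ultimately show ?thesis
    by (intro eq_if_coefficients_eq) (simp add: cinner_add_left)
qed

lemma D_minus_left: "D x g u + \<mu> x *\<^sub>C D (- x) g u = 0"
proof (rule eq_if_coefficients_eq)
  fix v
  have 1: "cinner (\<Phi> (- x - g) u) v = cinner (\<Phi> (x + g) u) v / (\<mu> x * \<mu> g)"
    using Phi_reflect[of "x + g" u] by (simp add: cinner_scaleC_left mu_add)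
  have 2: "cinner (\<Phi> (- x + g) u) v = \<mu> g / \<mu> x * cinner (\<Phi> (x - g) u) v"
    using coefficient_reflect[of g x u v] by simp
  show "cinner (D x g u + \<mu> x *\<^sub>C D (- x) g u) v = cinner 0 v"
    unfolding cinner_add_left cinner_scaleC_left coefficient_D 1 2 by (simp add: field_simps)
qed

text \<open>
  Hermiticity and \<open>\<Phi> (- x) = \<Phi> x / \<mu> x\<close> give both terms of \<open>D x y\<close> the same factor
  \<open>1 / \<mu> (x + y)\<close> on passing to adjoints.
\<close>

lemma D_adjoint: "cinner (D x y u) v = cinner u ((1 / \<mu> (x + y)) *\<^sub>C D x y v)"
proof -
  have "\<Phi> (- y) (\<Phi> (- x) v) = (1 / \<mu> (x + y)) *\<^sub>C \<Phi> x (\<Phi> y v)"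
    by (simp add: Phi_reflect Phi_scaleC scaleC_scaleC mu_add Phi_commute[of x y] mult.commute)
  then show ?thesis
    unfolding D_apply cinner_diff_left Phi_adjoint scaleC_diff_right cinner_diff_right
    by (simp only: Phi_reflect)
qed

lemma D_bounded: "D x y \<in> bounded_operators"
  by (simp add: bounded_operators_def D_apply Phi_scaleC scaleC_diff_right)

lemma D_zero [simp]: "D 0 0 = 0"
  by (rule blinfun_eqI) (simp add: D_apply)


section \<open>Commutant and bicommutant\<close>

definition commutant :: "('h \<Rightarrow>\<^sub>L 'h) set"
  where "commutant = {T \<in> bounded_operators. \<forall>x u. T (\<Phi> x u) = \<Phi> x (T u)}"

definition bicommutant :: "('h \<Rightarrow>\<^sub>L 'h) set"
  where "bicommutant = {N \<in> bounded_operators. \<forall>T\<in>commutant. \<forall>u. N (T u) = T (N u)}"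

lemma Phi_in_commutant: "\<Phi> x \<in> commutant"
  by (simp add: commutant_def Phi_bounded Phi_commute)

lemma bicommutant_commute: "N \<in> bicommutant \<Longrightarrow> T \<in> commutant \<Longrightarrow> N (T u) = T (N u)"
  by (simp add: bicommutant_def)

lemma commutant_scaleC: "T \<in> commutant \<Longrightarrow> T (a *\<^sub>C u) = a *\<^sub>C T u"
  by (simp add: commutant_def bounded_operators_def)

lemma bicommutant_subset_commutant:
  assumes "N \<in> bicommutant"
  shows "N \<in> commutant"
proof -
  have "N \<in> bounded_operators" using assms by (simp add: bicommutant_def)
  moreover have "\<forall>x u. N (\<Phi> x u) = \<Phi> x (N u)"
    using bicommutant_commute[OF assms Phi_in_commutant] by blast
  ultimately show ?thesis unfolding commutant_def by blast
qed

lemma D_commute: "T \<in> commutant \<Longrightarrow> T (D x y u) = D x y (T u)"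
  by (simp add: D_apply commutant_def blinfun.bilinear_simps)

lemma D_in_bicommutant: "D x y \<in> bicommutant"
  by (simp add: bicommutant_def D_bounded D_commute)

lemma compose_in_commutant: "S \<in> commutant \<Longrightarrow> T \<in> commutant \<Longrightarrow> S o\<^sub>L T \<in> commutant"
  by (simp add: commutant_def bounded_operators_def)

text \<open>
  This is why the orthogonal complement of a subspace invariant under the commutant is invariant too.
\<close>

lemma cadjoint_in_commutant:
  assumes "T \<in> commutant"
  shows "cadjoint T \<in> commutant"
proof -
  have T: "T \<in> bounded_operators" and comm: "\<And>x u. T (\<Phi> x u) = \<Phi> x (T u)"
    using assms by (auto simp: commutant_def)
  have "cadjoint T (\<Phi> x u) = \<Phi> x (cadjoint T u)" for x u
  proof (rule cinner_ext)
    fix y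
    have adj: "cinner a (\<Phi> x b) = cinner (\<Phi> (- x) a) b" for a b
      by (simp add: Phi_adjoint)
    show "cinner y (cadjoint T (\<Phi> x u)) = cinner y (\<Phi> x (cadjoint T u))"
      by (simp add: adj comm flip: cinner_cadjoint[OF T])
  qed
  with T show ?thesis by (simp add: commutant_def cadjoint_in_bounded_operators)
qed

section \<open>Sine functions at a single vector\<close>

text \<open>
  The three laws that make \<open>\<Phi> + N\<close> multiplicative and \<open>\<Phi>\<close> its \<open>\<mu>\<close>-mean, required at one vector
  only.
\<close>

definition sine_at :: "('g \<Rightarrow> 'h \<Rightarrow>\<^sub>L 'h) \<Rightarrow> 'h \<Rightarrow> bool"
  where "sine_at N l \<longleftrightarrow> (\<forall>x y. N x (N y l) = D x y l) \<and>
    (\<forall>x y. N (x + y) l = \<Phi> x (N y l) + N x (\<Phi> y l)) \<and> (\<forall>x. N x l + \<mu> x *\<^sub>C N (- x) l = 0)"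

text \<open>
  The bound that \<open>N x N x = D x x\<close> imposes on a normal operator \<open>N x\<close>.
\<close>

definition sine_bound :: "'g \<Rightarrow> real"
  where "sine_bound x = sqrt (norm (D x x))"

lemma sine_bound_nonneg [simp]: "0 \<le> sine_bound x"
  by (simp add: sine_bound_def)

lemma sine_bound_square: "(sine_bound x)\<^sup>2 = norm (D x x)"
  by (simp add: sine_bound_def)

lemma commute_with_commutant_in_bicommutant:
  assumes "T \<in> bounded_operators" "\<And>C. C \<in> commutant \<Longrightarrow> C o\<^sub>L T = T o\<^sub>L C"
  shows "T \<in> bicommutant"
  using assms by (auto simp: bicommutant_def) (metis blinfun_apply_blinfun_compose)

text \<open>
  A multiple \<open>s\<close> of \<open>A\<close> is a self-adjoint contraction.  Let \<open>Q\<close> be the square root of \<open>s\<^sup>2\<close>, the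
  absolute value of \<open>s\<close>.  On the range of \<open>Q + s\<close> the operator \<open>s\<close> agrees with \<open>Q\<close>, on the range of
  \<open>Q - s\<close> with \<open>- Q\<close>, and \<open>Q\<close> has a self-adjoint square root \<open>q\<close>.  So \<open>A\<close> is a scalar multiple of
  \<open>q\<^sup>2\<close> on the range of \<open>R = Q \<plusminus> s\<close>.  The sign is chosen such that \<open>R z \<noteq> 0\<close>.
\<close>

lemma local_square_root:
  assumes A: "A \<in> bicommutant" and adj: "\<And>u v. cinner (A u) v = cinner u (c *\<^sub>C A v)"
    and "A z \<noteq> 0"
  obtains R q \<kappa> where "R \<in> bicommutant" "q \<in> bicommutant" "self_adjoint q"
    "\<And>w. A (R w) = \<kappa> *\<^sub>C q (q (R w))" "A (R z) \<noteq> 0"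
proof -
  have A_C: "A (a *\<^sub>C u) = a *\<^sub>C A u" for a u
    by (rule commutant_scaleC[OF bicommutant_subset_commutant[OF A]])
  \<comment> \<open>Multiplication by a square root of the unimodular number \<open>c\<close> makes \<open>A\<close> self-adjoint.\<close>
  define \<omega> where "\<omega> = csqrt c"
  have "cmod c = 1" by (rule norm_square_if_adjoint_multiple(2)[OF adj \<open>A z \<noteq> 0\<close>])
  then have \<omega>: "cmod \<omega> = 1" "\<omega>\<^sup>2 = c" by (simp_all add: \<omega>_def)
  then have [simp]: "\<omega> \<noteq> 0" by auto
  have "\<omega> * cnj \<omega> = 1" using complex_norm_square[of \<omega>] \<omega>(1) by simp
  then have cnj_\<omega>: "cnj \<omega> * c = \<omega>" by (simp add: power2_eq_square mult_ac flip: \<omega>(2))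
  have [simp]: "norm A > 0" using \<open>A z \<noteq> 0\<close> by auto
  define s where "s = (\<omega> / norm A) *\<^sub>C A"
  have s_apply: "s u = (\<omega> / norm A) *\<^sub>C A u" for u by (simp add: s_def scaleC_blinfun.rep_eq)
  have A_s: "A u = (of_real (norm A) / \<omega>) *\<^sub>C s u" for u
    using \<open>norm A > 0\<close> by (simp add: s_apply scaleC_scaleC)
  have s_C: "s (a *\<^sub>C u) = a *\<^sub>C s u" for a u
    by (simp add: s_apply A_C scaleC_scaleC mult.commute)
  have s_bicomm: "s (C u) = C (s u)" if "C \<in> commutant" for C u
    by (simp add: s_apply bicommutant_commute[OF A that] commutant_scaleC[OF that])
  have s_sa: "cinner (s u) v = cinner u (s v)" for u v
    using cnj_\<omega>
    by (simp add: s_apply cinner_scaleC_left adj cinner_scaleC_right)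
      (metis complex_cnj_cnj complex_cnj_mult mult.commute)
  have "norm s = 1"
    using \<omega> \<open>norm A > 0\<close> by (simp add: s_def norm_scaleC norm_divide)
  then have s_le: "norm (s u) \<le> norm u" for u using norm_blinfun[of s u] by simp
  let ?T = "s o\<^sub>L s"
  have "norm (id_blinfun - ?T) \<le> 1"
  proof (rule norm_blinfun_bound)
    fix u
    have "(norm (u - s (s u)))\<^sup>2 = (norm u)\<^sup>2 - 2 * (norm (s u))\<^sup>2 + (norm (s (s u)))\<^sup>2"
      by (simp add: norm_diff_square power2_norm_eq_cinner[of "s u"] s_sa)
    also have "\<dots> \<le> (norm u)\<^sup>2"
      using power_mono[OF s_le norm_ge_zero, of "s u" 2] zero_le_power2[of "norm (s u)"] by linarith
    finally have "norm (u - s (s u)) \<le> norm u" by (rule power2_le_imp_le) simp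
    then show "norm ((id_blinfun - ?T) u) \<le> 1 * norm u" by (simp add: blinfun.diff_left)
  qed simp
  moreover have "?T \<in> bounded_operators" "self_adjoint ?T"
    by (simp_all add: bounded_operators_def s_C self_adjoint_def s_sa)
  ultimately obtain Q where Q: "Q \<in> bounded_operators" "self_adjoint Q" "norm (id_blinfun - Q) \<le> 1"
    "Q o\<^sub>L Q = ?T" "\<And>C. C o\<^sub>L ?T = ?T o\<^sub>L C \<Longrightarrow> C o\<^sub>L Q = Q o\<^sub>L C"
    using square_root_exists by blast
  obtain q where q: "q \<in> bounded_operators" "self_adjoint q"
    "q o\<^sub>L q = Q" "\<And>C. C o\<^sub>L Q = Q o\<^sub>L C \<Longrightarrow> C o\<^sub>L q = q o\<^sub>L C"
    using square_root_exists[OF Q(1-3)] by metis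
  have QQ: "Q (Q u) = s (s u)" for u using Q(4) by (metis blinfun_apply_blinfun_compose)
  have qq: "q (q u) = Q u" for u using q(3) by (metis blinfun_apply_blinfun_compose)
  have comm: "C o\<^sub>L Q = Q o\<^sub>L C" if "C \<in> commutant" for C
    by (rule Q(5)) (auto intro!: blinfun_eqI simp: s_bicomm[OF that])
  have "s o\<^sub>L Q = Q o\<^sub>L s" by (rule Q(5)) (auto intro!: blinfun_eqI)
  then have sQ: "s (Q u) = Q (s u)" for u by (metis blinfun_apply_blinfun_compose)
  have qb: "q \<in> bicommutant"
    by (rule commute_with_commutant_in_bicommutant[OF q(1) q(4)[OF comm]])
  have "s z \<noteq> 0" using \<open>A z \<noteq> 0\<close> A_s[of z] by auto
  \<comment> \<open>If both signs failed, then \<open>s z\<close> would vanish.\<close>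
  have "\<exists>e::real. e * e = 1 \<and> Q z + e *\<^sub>R s z \<noteq> 0"
  proof (cases "Q z + s z = 0")
    case True
    then have "Q z = - s z" by (simp add: eq_neg_iff_add_eq_0)
    then have "Q z + (-1) *\<^sub>R s z = - (2 *\<^sub>R s z)" by (simp add: scaleR_2)
    with \<open>s z \<noteq> 0\<close> show ?thesis by (intro exI[of _ "-1"]) simp
  qed (auto intro: exI[of _ 1])
  then obtain e :: real where e: "e * e = 1" "Q z + e *\<^sub>R s z \<noteq> 0" by blast
  define R where "R = Q + e *\<^sub>R s"
  have R_apply: "R u = Q u + e *\<^sub>R s u" for u by (simp add: R_def blinfun.bilinear_simps)
  have sR: "s (R u) = e *\<^sub>R Q (R u)" for u
    using e(1) by (simp add: R_apply blinfun.bilinear_simps sQ QQ scaleR_add_right)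
  have AR: "A (R w) = (of_real (norm A) / \<omega> * e) *\<^sub>C q (q (R w))" for w
    by (simp add: A_s[of "R w"] sR qq scaleR_scaleC scaleC_scaleC)
  have Rb: "R \<in> bicommutant"
  proof (rule commute_with_commutant_in_bicommutant)
    show "R \<in> bounded_operators"
      using Q(1) by (simp add: bounded_operators_def R_apply s_C scaleC_add_right scaleC_scaleR)
    fix C assume "C \<in> commutant"
    then have "C (Q u) = Q (C u)" for u using comm by (metis blinfun_apply_blinfun_compose)
    then show "C o\<^sub>L R = R o\<^sub>L C"
      by (intro blinfun_eqI) (simp add: R_apply blinfun.bilinear_simps s_bicomm[OF \<open>C \<in> commutant\<close>])
  qed
  have "A (R z) \<noteq> 0"
  proof
    assume "A (R z) = 0"
    then have "s (R z) = 0" by (simp add: s_apply)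
    then have "Q (R z) = 0" using sR[of z] e(1) by auto
    with \<open>s (R z) = 0\<close> have "R (R z) = 0" by (simp add: R_apply[of "R z"])
    moreover have "cinner (R z) (R z) = cinner z (R (R z))"
      using Q(2) by (subst (1 3) R_apply) (simp add: self_adjoint_def cinner_add_left cinner_add_right
          cinner_scaleR_left cinner_scaleR_right s_sa)
    ultimately have "R z = 0" by (simp add: cinner_eq_zero_iff)
    then show False using e(2) by (simp add: R_apply)
  qed
  then show ?thesis by (rule that[OF Rb qb q(2) AR])
qed

text \<open>
  The factor is forced on the range of \<open>B\<close> and is put to 0 on its orthogonal complement.
  Both subspaces are invariant under the commutant, so the factor commutes with the commutant.
\<close>

lemma bounded_factorization:
  assumes B: "B \<in> bicommutant" and K: "K \<in> bicommutant"
    and bound: "\<And>w. norm (K w) \<le> C * norm (B w)" and "0 \<le> C"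
  obtains F where "F \<in> bicommutant" "norm F \<le> C" "\<And>w. F (B w) = K w"
proof -
  have lin: "B (a *\<^sub>C u) = a *\<^sub>C B u" "K (a *\<^sub>C u) = a *\<^sub>C K u" for a u
    using B K by (auto intro: commutant_scaleC bicommutant_subset_commutant)
  have graph: "clinear_graph (range (\<lambda>w. (B w, K w)))"
  proof (rule clinear_graphI)
    show "(0, 0) \<in> range (\<lambda>w. (B w, K w))" by (rule range_eqI[of _ _ 0]) simp
  next
    fix u w u' w' assume "(u, w) \<in> range (\<lambda>w. (B w, K w))" "(u', w') \<in> range (\<lambda>w. (B w, K w))"
    then obtain a a' where "u = B a" "w = K a" "u' = B a'" "w' = K a'" by blast
    then show "(u + u', w + w') \<in> range (\<lambda>w. (B w, K w))"
      by (intro range_eqI[of _ _ "a + a'"]) (simp add: blinfun.add_right)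
  next
    fix c u w assume "(u, w) \<in> range (\<lambda>w. (B w, K w))"
    then obtain a where "u = B a" "w = K a" by blast
    then show "(c *\<^sub>C u, c *\<^sub>C w) \<in> range (\<lambda>w. (B w, K w))"
      by (intro range_eqI[of _ _ "c *\<^sub>C a"]) (simp add: lin)
  qed
  obtain F where F: "F \<in> bounded_operators" "norm F \<le> C"
    "\<And>u w. (u, w) \<in> range (\<lambda>w. (B w, K w)) \<Longrightarrow> F u = w"
    "\<And>z. (\<And>u w. (u, w) \<in> range (\<lambda>w. (B w, K w)) \<Longrightarrow> cinner z u = 0) \<Longrightarrow> F z = 0"
    by (rule bounded_graph_extension[OF graph, of C]) (use bound \<open>0 \<le> C\<close> in auto)
  have FB: "F (B w) = K w" for w by (rule F(3)) blast
  have F0: "F z = 0" if "\<And>w. cinner z (B w) = 0" for z by (rule F(4)) (use that in auto)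
  have "F \<in> bicommutant"
  proof (rule commute_with_commutant_in_bicommutant[OF F(1)])
    fix T assume T: "T \<in> commutant"
    have "csubspace (range B)" using csubspace_Domain[OF graph] by (simp add: Domain_fst image_image)
    then show "T o\<^sub>L F = F o\<^sub>L T"
    proof (rule blinfun_eq_on_subspace_and_complement)
      fix v assume "v \<in> range B"
      then obtain w where "v = B w" by blast
      then show "(T o\<^sub>L F) v = (F o\<^sub>L T) v"
        using bicommutant_commute[OF B T] bicommutant_commute[OF K T]
        by (simp add: FB) (metis FB)
    next
      fix z assume z: "\<And>v. v \<in> range B \<Longrightarrow> cinner z v = 0"
      have Tb: "T \<in> bounded_operators" using T by (simp add: commutant_def)
      have "cinner (T z) (B w) = 0" for w
        using z bicommutant_commute[OF B cadjoint_in_commutant[OF T], of w]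
        by (metis cinner_cadjoint[OF Tb] rangeI)
      with z show "(T o\<^sub>L F) z = (F o\<^sub>L T) z" by (simp add: F0)
    qed
  qed
  then show ?thesis using that F(2) FB by blast
qed

lemma bicommutant_mult:
  assumes "S \<in> bicommutant" "T \<in> bicommutant"
  shows "S o\<^sub>L T \<in> bicommutant"
  using assms by (auto simp: bicommutant_def bounded_operators_def)

text \<open>
  With \<open>b\<close> a square root of \<open>D g g\<close> on the range of \<open>R\<close>, the operator \<open>N x\<close> is defined by
  \<open>N x b = D x g\<close> on that range.  The identities for \<open>D\<close> then give the laws of a sine on the range of
  \<open>b b R = D g g R\<close>.  The second factor \<open>b\<close> is there because two successive applications of \<open>N\<close> need
  two factors \<open>b\<close>.
\<close>

lemma local_sine:
  assumes "z \<noteq> 0"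
  obtains N T where "\<And>x. N x \<in> bicommutant" "\<And>x. norm (N x) \<le> sine_bound x"
    "T \<in> commutant" "T z \<noteq> 0" "sine_at N (T z)"
proof (cases "\<exists>g. D g g z \<noteq> 0")
  case False
  \<comment> \<open>If all squared sines vanish at \<open>z\<close>, then \<open>\<Phi>\<close> itself is multiplicative there and \<open>N = 0\<close> works.\<close>
  have "D x y z = 0" for x y
  proof -
    have "(norm (D x y z))\<^sup>2 = cmod (cinner (D x y (D x y z)) z)"
      by (rule norm_square_if_adjoint_multiple(1)[OF D_adjoint])
    also have "D x y (D x y z) = D x x (D y y z)" by (rule D_D_symmetric)
    finally show ?thesis using False by simp
  qed
  then show ?thesis
    by (intro that[of "\<lambda>_. 0" id_blinfun])
      (use assms in \<open>simp_all add: sine_at_def bicommutant_def commutant_def bounded_operators_def\<close>)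
next
  case True
  then obtain g where "D g g z \<noteq> 0" by blast
  then obtain R q \<kappa> where R: "R \<in> bicommutant" and q: "q \<in> bicommutant" "self_adjoint q"
    and root: "\<And>w. D g g (R w) = \<kappa> *\<^sub>C q (q (R w))" and nz: "D g g (R z) \<noteq> 0"
    using local_square_root[OF D_in_bicommutant D_adjoint] by blast
  define \<nu> where "\<nu> = csqrt \<kappa>"
  have \<nu>: "\<nu> * \<nu> = \<kappa>" by (simp add: \<nu>_def flip: power2_eq_square)
  define b where "b = \<nu> *\<^sub>C q"
  have b_apply: "b u = \<nu> *\<^sub>C q u" for u by (simp add: b_def scaleC_blinfun.rep_eq)
  have q_C: "q (a *\<^sub>C u) = a *\<^sub>C q u" for a u
    by (rule commutant_scaleC[OF bicommutant_subset_commutant[OF q(1)]])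
  have b: "b \<in> bicommutant"
    using q(1) by (auto simp: bicommutant_def bounded_operators_def b_apply q_C scaleC_scaleC
        mult.commute commutant_scaleC)
  have bb: "b (b (R w)) = D g g (R w)" for w
    by (simp add: b_apply q_C scaleC_scaleC \<nu> root)
  have bound: "norm (D x g (R w)) \<le> sine_bound x * norm (b (R w))" for x w
  proof -
    have "(norm (D x g (R w)))\<^sup>2 = cmod (cinner (D x g (D x g (R w))) (R w))"
      by (rule norm_square_if_adjoint_multiple(1)[OF D_adjoint])
    also have "D x g (D x g (R w)) = D x x (\<kappa> *\<^sub>C q (q (R w)))"
      using D_D_symmetric[of x g x] by (simp add: root)
    also have "\<dots> = \<kappa> *\<^sub>C q (D x x (q (R w)))"
      using D_commute[OF bicommutant_subset_commutant[OF q(1)]]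
      by (simp add: commutant_scaleC[OF bicommutant_subset_commutant[OF D_in_bicommutant]])
    also have "cmod (cinner (\<kappa> *\<^sub>C q (D x x (q (R w)))) (R w))
        = cmod \<kappa> * cmod (cinner (D x x (q (R w))) (q (R w)))"
      using q(2) by (simp add: cinner_scaleC_left norm_mult self_adjoint_def)
    also have "\<dots> \<le> cmod \<kappa> * ((norm (D x x) * norm (q (R w))) * norm (q (R w)))"
      by (intro mult_left_mono order_trans[OF cmod_cinner_le] mult_right_mono norm_blinfun) simp_all
    also have "\<dots> = (sine_bound x * norm (b (R w)))\<^sup>2"
      by (simp add: b_apply norm_scaleC power_mult_distrib sine_bound_square norm_mult flip: \<nu>)
        (simp add: power2_eq_square)
    finally show ?thesis by (rule power2_le_imp_le) simp
  qed
  have "\<exists>F. F \<in> bicommutant \<and> norm F \<le> sine_bound x \<and> (\<forall>w. F (b (R w)) = D x g (R w))" for x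
  proof -
    have "norm ((D x g o\<^sub>L R) w) \<le> sine_bound x * norm ((b o\<^sub>L R) w)" for w
      by (simp add: bound)
    then obtain F where "F \<in> bicommutant" "norm F \<le> sine_bound x"
      "\<And>w. F ((b o\<^sub>L R) w) = (D x g o\<^sub>L R) w"
      using bounded_factorization[OF bicommutant_mult[OF b R] bicommutant_mult[OF D_in_bicommutant R]
          _ sine_bound_nonneg] by blast
    then show ?thesis by auto
  qed
  then obtain N where N: "\<And>x. N x \<in> bicommutant" "\<And>x. norm (N x) \<le> sine_bound x"
    "\<And>x w. N x (b (R w)) = D x g (R w)" by metis
  note comm = bicommutant_subset_commutant
  have N_l: "N x (D g g (R z)) = D x g (b (R z))" for x
  proof -
    have "N x (b (b (R z))) = b (N x (b (R z)))" by (rule bicommutant_commute[OF N(1) comm[OF b]])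
    then show ?thesis using D_commute[OF comm[OF b]] by (simp add: N(3) bb)
  qed
  have "sine_at N (D g g (R z))"
    unfolding sine_at_def
  proof (intro conjI allI)
    fix x y
    have "N x (N y (D g g (R z))) = N x (b (R (D y g z)))"
      using D_commute[OF comm[OF b]] D_commute[OF comm[OF R]] by (simp add: N_l)
    also have "\<dots> = D x g (D y g (R z))"
      by (simp only: N(3) flip: D_commute[OF comm[OF R]])
    also have "\<dots> = D x y (D g g (R z))" by (rule D_D_symmetric)
    finally show "N x (N y (D g g (R z))) = D x y (D g g (R z))" .
    have "N x (\<Phi> y (D g g (R z))) = \<Phi> y (N x (D g g (R z)))"
      by (rule bicommutant_commute[OF N(1) Phi_in_commutant])
    then show "N (x + y) (D g g (R z)) = \<Phi> x (N y (D g g (R z))) + N x (\<Phi> y (D g g (R z)))"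
      by (simp add: N_l D_add_left Phi_D_commute)
    show "N x (D g g (R z)) + \<mu> x *\<^sub>C N (- x) (D g g (R z)) = 0"
      by (simp add: N_l D_minus_left)
  qed
  then show ?thesis
    using that[of N "D g g o\<^sub>L R"] N nz compose_in_commutant[OF comm[OF D_in_bicommutant] comm[OF R]]
    by simp
qed

end

section \<open>Gluing the local sine functions\<close>

text \<open>
  The triple \<open>(x, u, w)\<close> in \<open>\<Gamma>\<close> means \<open>N x u = w\<close> for a partially defined sine function \<open>N\<close>.  Every
  condition has at most two premises about \<open>\<Gamma>\<close>, so it passes to unions of chains;
  by the law \<open>addition\<close>, the domain does not depend on \<open>x\<close>.  Its
  invariance under the commutant allows a local solution to be added on the orthogonal complement.
\<close>

locale partial_sine = hermitian_cosine \<mu> \<Phi>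
  for \<mu> :: "'g::topological_ab_group_add \<Rightarrow> complex" and \<Phi> :: "'g \<Rightarrow> 'h::chilbert_space \<Rightarrow>\<^sub>L 'h" +
  fixes \<Gamma> :: "('g \<times> 'h \<times> 'h) set"
  assumes zero: "(x, 0, 0) \<in> \<Gamma>"
    and add: "(x, u, w) \<in> \<Gamma> \<Longrightarrow> (x, u', w') \<in> \<Gamma> \<Longrightarrow> (x, u + u', w + w') \<in> \<Gamma>"
    and scaleC: "(x, u, w) \<in> \<Gamma> \<Longrightarrow> (x, a *\<^sub>C u, a *\<^sub>C w) \<in> \<Gamma>"
    and bound: "(x, u, w) \<in> \<Gamma> \<Longrightarrow> norm w \<le> sine_bound x * norm u"
    and commutant: "T \<in> commutant \<Longrightarrow> (x, u, w) \<in> \<Gamma> \<Longrightarrow> (x, T u, T w) \<in> \<Gamma>"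
    and product: "(y, u, v) \<in> \<Gamma> \<Longrightarrow> (x, v, D x y u) \<in> \<Gamma>"
    and addition: "(x, u, v) \<in> \<Gamma> \<Longrightarrow> \<exists>w. (y, u, w) \<in> \<Gamma> \<and> (x + y, u, \<Phi> x w + \<Phi> y v) \<in> \<Gamma>"
    and minus: "(x, u, w) \<in> \<Gamma> \<Longrightarrow> (- x, u, (- 1 / \<mu> x) *\<^sub>C w) \<in> \<Gamma>"
begin

lemma graph: "clinear_graph (\<Gamma> `` {x})"
  by (rule clinear_graphI) (auto intro: zero add scaleC)

end

context hermitian_cosine
begin

lemma partial_sine_Union:
  assumes "\<C> \<noteq> {}" and chain: "subset.chain {\<Gamma>. partial_sine \<mu> \<Phi> \<Gamma>} \<C>"
  shows "partial_sine \<mu> \<Phi> (\<Union>\<C>)"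
proof -
  have ps: "partial_sine \<mu> \<Phi> \<Gamma>" if "\<Gamma> \<in> \<C>" for \<Gamma>
    using chain that by (auto simp: subset.chain_def)
  have common: "\<exists>\<Gamma>\<in>\<C>. a \<in> \<Gamma> \<and> b \<in> \<Gamma>" if "a \<in> \<Union>\<C>" "b \<in> \<Union>\<C>" for a b
    using chain that unfolding subset.chain_def by blast
  show ?thesis
  proof (unfold_locales)
    show "(x, 0, 0) \<in> \<Union>\<C>" for x using assms(1) partial_sine.zero[OF ps] by blast
    show "(x, u + u', w + w') \<in> \<Union>\<C>" if "(x, u, w) \<in> \<Union>\<C>" "(x, u', w') \<in> \<Union>\<C>" for x u w u' w'
      using common[OF that] partial_sine.add[OF ps] by blast
    show "(x, a *\<^sub>C u, a *\<^sub>C w) \<in> \<Union>\<C>" if "(x, u, w) \<in> \<Union>\<C>" for a x u w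
      using that partial_sine.scaleC[OF ps] by blast
    show "norm w \<le> sine_bound x * norm u" if "(x, u, w) \<in> \<Union>\<C>" for x u w
      using that partial_sine.bound[OF ps] by blast
    show "(x, T u, T w) \<in> \<Union>\<C>" if "T \<in> commutant" "(x, u, w) \<in> \<Union>\<C>" for T x u w
      using that partial_sine.commutant[OF ps] by blast
    show "(x, v, D x y u) \<in> \<Union>\<C>" if "(y, u, v) \<in> \<Union>\<C>" for x y u v
      using that partial_sine.product[OF ps] by blast
    show "\<exists>w. (y, u, w) \<in> \<Union>\<C> \<and> (x + y, u, \<Phi> x w + \<Phi> y v) \<in> \<Union>\<C>"
      if uv: "(x, u, v) \<in> \<Union>\<C>" for x y u v
    proof -
      obtain \<Gamma> where \<Gamma>: "\<Gamma> \<in> \<C>" "(x, u, v) \<in> \<Gamma>" using uv by blast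
      show ?thesis using partial_sine.addition[OF ps[OF \<Gamma>(1)] \<Gamma>(2), of y] \<Gamma>(1) by blast
    qed
    show "(- x, u, (- 1 / \<mu> x) *\<^sub>C w) \<in> \<Union>\<C>" if "(x, u, w) \<in> \<Union>\<C>" for x u w
      using that partial_sine.minus[OF ps] by blast
  qed
qed

lemma sine_at_commutant:
  assumes N: "\<And>x. N x \<in> bicommutant" and "sine_at N l" and T: "T \<in> commutant"
  shows "sine_at N (T l)"
proof -
  have [simp]: "N x (T u) = T (N x u)" for x u by (rule bicommutant_commute[OF N T])
  have [simp]: "\<Phi> x (T u) = T (\<Phi> x u)" for x u using T by (simp add: commutant_def)
  show ?thesis
    using assms(2) D_commute[OF T]
    by (simp add: sine_at_def blinfun.add_right flip: blinfun.add_right commutant_scaleC[OF T])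
qed

text \<open>
  Let \<open>N\<close> be a local sine for a vector \<open>z\<close> orthogonal to the domain, and let \<open>L\<close> consist of all
  vectors orthogonal to the domain at which \<open>N\<close> satisfies the laws of a sine.  As \<open>N\<close> lies in the
  bicommutant, \<open>L\<close> is invariant under the commutant and hence under \<open>N\<close>, so the orthogonal sum of the
  given partial sine and the restriction of \<open>N\<close> to \<open>L\<close> is a partial sine.  It is larger because \<open>L\<close>
  contains the nonzero vector \<open>T z\<close> at which the local sine was constructed.
\<close>

lemma partial_sine_extend:
  assumes \<Gamma>: "partial_sine \<mu> \<Phi> \<Gamma>" and "z \<noteq> 0"
    and z: "\<And>x u w. (x, u, w) \<in> \<Gamma> \<Longrightarrow> cinner z u = 0"
  obtains \<Gamma>' where "partial_sine \<mu> \<Phi> \<Gamma>'" "\<Gamma> \<subset> \<Gamma>'"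
proof -
  obtain N T where N: "\<And>x. N x \<in> bicommutant" "\<And>x. norm (N x) \<le> sine_bound x"
    and T: "T \<in> commutant" "T z \<noteq> 0" "sine_at N (T z)"
    using local_sine[OF \<open>z \<noteq> 0\<close>] by blast
  define L where "L = {l. (\<forall>x u w. (x, u, w) \<in> \<Gamma> \<longrightarrow> cinner l u = 0) \<and> sine_at N l}"
  have orth_commutant: "cinner (S l) u = 0"
    if l: "\<And>x u w. (x, u, w) \<in> \<Gamma> \<Longrightarrow> cinner l u = 0" and S: "S \<in> commutant" and u: "(x, u, w) \<in> \<Gamma>"
    for S l x u w
  proof -
    have "S \<in> bounded_operators" using S by (simp add: commutant_def)
    then have "cinner (S l) u = cinner l (cadjoint S u)" by (rule cinner_cadjoint)
    also have "\<dots> = 0"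
      by (rule l[OF partial_sine.commutant[OF \<Gamma> cadjoint_in_commutant[OF S] u]])
    finally show ?thesis .
  qed
  have L_commutant: "S l \<in> L" if l: "l \<in> L" and S: "S \<in> commutant" for S l
  proof -
    have "sine_at N (S l)" using l by (intro sine_at_commutant N(1) S) (simp add: L_def)
    moreover have "cinner (S l) u = 0" if "(x, u, w) \<in> \<Gamma>" for x u w
      by (rule orth_commutant[OF _ S that]) (use l in \<open>auto simp: L_def\<close>)
    ultimately show ?thesis unfolding L_def by blast
  qed
  have L_N: "N x l \<in> L" if "l \<in> L" for x l
    using L_commutant[OF that bicommutant_subset_commutant[OF N(1)]] .
  have L_sine: "sine_at N l" and L_orth: "(x, u, w) \<in> \<Gamma> \<Longrightarrow> cinner l u = 0" if "l \<in> L" for l x u w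
    using that by (auto simp: L_def)
  have N_C: "N x (a *\<^sub>C u) = a *\<^sub>C N x u" for a x u
    by (rule commutant_scaleC[OF bicommutant_subset_commutant[OF N(1)]])
  have L_zero: "0 \<in> L" by (simp add: L_def sine_at_def)
  have L_add: "l + l' \<in> L" if "l \<in> L" "l' \<in> L" for l l'
  proof -
    have "sine_at N (l + l')"
      using L_sine[OF that(1)] L_sine[OF that(2)] unfolding sine_at_def
      by (simp add: blinfun.add_right scaleC_add_right algebra_simps)
    then show ?thesis using that by (simp add: L_def cinner_add_left)
  qed
  have L_scale: "a *\<^sub>C l \<in> L" if "l \<in> L" for a l
  proof -
    have "a *\<^sub>C id_blinfun \<in> commutant"
      by (simp add: commutant_def bounded_operators_def scaleC_blinfun.rep_eq scaleC_scaleC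
          Phi_scaleC mult.commute)
    from L_commutant[OF that this] show ?thesis by (simp add: scaleC_blinfun.rep_eq)
  qed
  define \<Gamma>' where "\<Gamma>' = {(x, u + l, w + N x l) | x u w l. (x, u, w) \<in> \<Gamma> \<and> l \<in> L}"
  have I: "(x, a, b) \<in> \<Gamma>'" if "(x, u, w) \<in> \<Gamma>" "l \<in> L" "a = u + l" "b = w + N x l" for x u w l a b
    using that unfolding \<Gamma>'_def by blast
  have E: "\<exists>u w l. (x, u, w) \<in> \<Gamma> \<and> l \<in> L \<and> a = u + l \<and> b = w + N x l" if "(x, a, b) \<in> \<Gamma>'" for x a b
    using that unfolding \<Gamma>'_def by blast
  have "partial_sine \<mu> \<Phi> \<Gamma>'"
  proof (unfold_locales)
    show "(x, 0, 0) \<in> \<Gamma>'" for x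
      by (rule I[OF partial_sine.zero[OF \<Gamma>] L_zero]) simp_all
  next
    fix x a b a' b' assume "(x, a, b) \<in> \<Gamma>'" "(x, a', b') \<in> \<Gamma>'"
    then obtain u w l u' w' l' where *: "(x, u, w) \<in> \<Gamma>" "l \<in> L" "a = u + l" "b = w + N x l"
      "(x, u', w') \<in> \<Gamma>" "l' \<in> L" "a' = u' + l'" "b' = w' + N x l'"
      by (metis E)
    show "(x, a + a', b + b') \<in> \<Gamma>'"
      by (rule I[OF partial_sine.add[OF \<Gamma> *(1,5)] L_add[OF *(2,6)]])
        (simp_all add: * blinfun.add_right algebra_simps)
  next
    fix c x a b assume "(x, a, b) \<in> \<Gamma>'"
    then obtain u w l where *: "(x, u, w) \<in> \<Gamma>" "l \<in> L" "a = u + l" "b = w + N x l" by (metis E)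
    show "(x, c *\<^sub>C a, c *\<^sub>C b) \<in> \<Gamma>'"
      by (rule I[OF partial_sine.scaleC[OF \<Gamma> *(1)] L_scale[OF *(2)]])
        (simp_all add: * N_C scaleC_add_right)
  next
    fix x a b assume "(x, a, b) \<in> \<Gamma>'"
    then obtain u w l where *: "(x, u, w) \<in> \<Gamma>" "l \<in> L" "a = u + l" "b = w + N x l" by (metis E)
    have "cinner (N x l) w = 0"
      by (rule L_orth[OF L_N[OF *(2)] partial_sine.product[OF \<Gamma> *(1)]])
    then have "(norm b)\<^sup>2 = (norm (N x l))\<^sup>2 + (norm w)\<^sup>2"
      using norm_add_square_orth[of "N x l" w] * by (simp add: add.commute)
    also have "norm (N x l) \<le> sine_bound x * norm l"
      using norm_blinfun[of "N x" l] mult_right_mono[OF N(2) norm_ge_zero] order_trans by blast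
    then have "(norm (N x l))\<^sup>2 + (norm w)\<^sup>2 \<le> (sine_bound x * norm l)\<^sup>2 + (sine_bound x * norm u)\<^sup>2"
      by (intro add_mono power_mono partial_sine.bound[OF \<Gamma> *(1)]) simp_all
    also have "\<dots> = (sine_bound x * norm a)\<^sup>2"
      using norm_add_square_orth[OF L_orth[OF *(2,1)]] *
      by (simp add: power_mult_distrib distrib_left add.commute)
    finally show "norm b \<le> sine_bound x * norm a" by (rule power2_le_imp_le) simp
  next
    fix S x a b assume S: "S \<in> commutant" and "(x, a, b) \<in> \<Gamma>'"
    then obtain u w l where *: "(x, u, w) \<in> \<Gamma>" "l \<in> L" "a = u + l" "b = w + N x l" by (metis E)
    show "(x, S a, S b) \<in> \<Gamma>'"
      by (rule I[OF partial_sine.commutant[OF \<Gamma> S *(1)] L_commutant[OF *(2) S]])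
        (simp_all add: * blinfun.add_right bicommutant_commute[OF N(1) S])
  next
    fix x y a b assume "(y, a, b) \<in> \<Gamma>'"
    then obtain u w l where *: "(y, u, w) \<in> \<Gamma>" "l \<in> L" "a = u + l" "b = w + N y l" by (metis E)
    show "(x, b, D x y a) \<in> \<Gamma>'"
      by (rule I[OF partial_sine.product[OF \<Gamma> *(1)] L_N[OF *(2)]])
        (use L_sine[OF *(2)] in \<open>simp_all add: * blinfun.add_right sine_at_def\<close>)
  next
    fix x y a b assume "(x, a, b) \<in> \<Gamma>'"
    then obtain u w l where *: "(x, u, w) \<in> \<Gamma>" "l \<in> L" "a = u + l" "b = w + N x l" by (metis E)
    obtain v where v: "(y, u, v) \<in> \<Gamma>" "(x + y, u, \<Phi> x v + \<Phi> y w) \<in> \<Gamma>"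
      using partial_sine.addition[OF \<Gamma> *(1)] by blast
    have "(y, a, v + N y l) \<in> \<Gamma>'" by (rule I[OF v(1) *(2,3) refl])
    moreover have "N x (\<Phi> y l) = \<Phi> y (N x l)" by (rule bicommutant_commute[OF N(1) Phi_in_commutant])
    then have "(x + y, a, \<Phi> x (v + N y l) + \<Phi> y b) \<in> \<Gamma>'"
      by (intro I[OF v(2) *(2,3)])
        (use L_sine[OF *(2)] in \<open>simp add: * blinfun.add_right sine_at_def\<close>)
    ultimately show "\<exists>w. (y, a, w) \<in> \<Gamma>' \<and> (x + y, a, \<Phi> x w + \<Phi> y b) \<in> \<Gamma>'" by blast
  next
    fix x a b assume "(x, a, b) \<in> \<Gamma>'"
    then obtain u w l where *: "(x, u, w) \<in> \<Gamma>" "l \<in> L" "a = u + l" "b = w + N x l" by (metis E)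
    have "N x l + \<mu> x *\<^sub>C N (- x) l = 0" using L_sine[OF *(2)] by (simp add: sine_at_def)
    then have "N x l = - (\<mu> x *\<^sub>C N (- x) l)" by (simp only: eq_neg_iff_add_eq_0)
    then have "(- 1 / \<mu> x) *\<^sub>C N x l = N (- x) l"
      by (simp add: scaleC_minus_left scaleC_minus_right scaleC_scaleC)
    then show "(- x, a, (- 1 / \<mu> x) *\<^sub>C b) \<in> \<Gamma>'"
      by (intro I[OF partial_sine.minus[OF \<Gamma> *(1)] *(2,3)]) (simp add: * scaleC_add_right)
  qed
  moreover have "\<Gamma> \<subseteq> \<Gamma>'"
  proof
    fix p assume "p \<in> \<Gamma>"
    then show "p \<in> \<Gamma>'" by (cases p) (auto intro: I[OF _ L_zero])
  qed
  moreover have "\<Gamma> \<noteq> \<Gamma>'"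
  proof
    assume eq: "\<Gamma> = \<Gamma>'"
    have "cinner (T z) u = 0" if "(x, u, w) \<in> \<Gamma>" for x u w
      by (rule orth_commutant[OF _ T(1) that]) (rule z)
    then have "T z \<in> L" using T(3) unfolding L_def by blast
    then have "(0, 0 + T z, 0 + N 0 (T z)) \<in> \<Gamma>'"
      by (intro I[OF partial_sine.zero[OF \<Gamma>]]) simp_all
    then have "cinner (T z) (0 + T z) = 0" using L_orth[OF \<open>T z \<in> L\<close>] eq by blast
    with T(2) show False by (simp add: cinner_eq_zero_iff)
  qed
  ultimately show ?thesis using that by blast
qed

text \<open>
  The domain of a maximal partial sine has trivial orthogonal complement, so its laws extend
  from there to the whole space by continuity.
\<close>

lemma global_sine:
  obtains N where "\<And>x. N x \<in> bounded_operators" "\<And>x. norm (N x) \<le> sine_bound x" "\<And>u. sine_at N u"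
    "\<And>x y u. N x (\<Phi> y u) = \<Phi> y (N x u)"
proof -
  have "partial_sine \<mu> \<Phi> {(x, 0, 0) | x. True}"
    by (unfold_locales) auto
  then have "{\<Gamma>. partial_sine \<mu> \<Phi> \<Gamma>} \<noteq> {}" by blast
  then obtain \<Gamma> where \<Gamma>: "partial_sine \<mu> \<Phi> \<Gamma>"
    and max: "\<And>\<Gamma>'. partial_sine \<mu> \<Phi> \<Gamma>' \<Longrightarrow> \<Gamma> \<subseteq> \<Gamma>' \<Longrightarrow> \<Gamma>' = \<Gamma>"
    using subset_Zorn_nonempty[of "{\<Gamma>. partial_sine \<mu> \<Phi> \<Gamma>}"] partial_sine_Union by (metis mem_Collect_eq)
  define V where "V = {u. \<exists>w. (0, u, w) \<in> \<Gamma>}"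
  have V_iff: "u \<in> V \<longleftrightarrow> (\<exists>w. (x, u, w) \<in> \<Gamma>)" for x u
    using partial_sine.addition[OF \<Gamma>] unfolding V_def by blast
  have "V = Domain (\<Gamma> `` {0})" by (auto simp: V_def)
  then have V: "csubspace V" using csubspace_Domain[OF partial_sine.graph[OF \<Gamma>]] by simp
  have dense: "z = 0" if orth: "\<And>v. v \<in> V \<Longrightarrow> cinner z v = 0" for z
  proof (rule ccontr)
    assume "z \<noteq> 0"
    have "cinner z u = 0" if "(x, u, w) \<in> \<Gamma>" for x u w using orth V_iff that by blast
    then obtain \<Gamma>' where "partial_sine \<mu> \<Phi> \<Gamma>'" "\<Gamma> \<subset> \<Gamma>'"
      using partial_sine_extend[OF \<Gamma> \<open>z \<noteq> 0\<close>] by blast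
    with max show False by blast
  qed
  have eqI: "S = T" if "\<And>v. v \<in> V \<Longrightarrow> S v = T v" for S T :: "'h \<Rightarrow>\<^sub>L 'h"
  proof (rule blinfun_eq_on_subspace_and_complement[OF V that])
    show "S z = T z" if "\<And>v. v \<in> V \<Longrightarrow> cinner z v = 0" for z using dense[OF that] by simp
  qed
  have "\<exists>F. F \<in> bounded_operators \<and> norm F \<le> sine_bound x \<and> (\<forall>u w. (x, u, w) \<in> \<Gamma> \<longrightarrow> F u = w)" for x
  proof -
    have "norm w \<le> sine_bound x * norm u" if "(u, w) \<in> \<Gamma> `` {x}" for u w
      using that partial_sine.bound[OF \<Gamma>] by blast
    then obtain F where "F \<in> bounded_operators" "norm F \<le> sine_bound x"
      "\<And>u w. (u, w) \<in> \<Gamma> `` {x} \<Longrightarrow> F u = w"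
      using bounded_graph_extension[OF partial_sine.graph[OF \<Gamma>], of x "sine_bound x"] sine_bound_nonneg by metis
    then show ?thesis by blast
  qed
  then obtain N where N: "\<And>x. N x \<in> bounded_operators" "\<And>x. norm (N x) \<le> sine_bound x"
    "\<And>x u w. (x, u, w) \<in> \<Gamma> \<Longrightarrow> N x u = w" by metis
  have in_\<Gamma>: "(x, u, N x u) \<in> \<Gamma>" if "u \<in> V" for x u
    using that N(3) V_iff[of u x] by metis
  have "N x o\<^sub>L N y = D x y" for x y
    by (rule eqI) (use N(3)[OF partial_sine.product[OF \<Gamma> in_\<Gamma>]] in simp)
  then have product: "N x (N y u) = D x y u" for x y u by (metis blinfun_apply_blinfun_compose)
  have "N x o\<^sub>L \<Phi> y = \<Phi> y o\<^sub>L N x" for x y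
    by (rule eqI) (use N(3)[OF partial_sine.commutant[OF \<Gamma> Phi_in_commutant in_\<Gamma>]] in simp)
  then have commute: "N x (\<Phi> y u) = \<Phi> y (N x u)" for x y u by (metis blinfun_apply_blinfun_compose)
  have "N (x + y) = (\<Phi> x o\<^sub>L N y) + (\<Phi> y o\<^sub>L N x)" for x y
  proof (rule eqI)
    fix v assume "v \<in> V"
    then obtain w where "(y, v, w) \<in> \<Gamma>" "(x + y, v, \<Phi> x w + \<Phi> y (N x v)) \<in> \<Gamma>"
      using partial_sine.addition[OF \<Gamma> in_\<Gamma>] by blast
    then show "N (x + y) v = ((\<Phi> x o\<^sub>L N y) + (\<Phi> y o\<^sub>L N x)) v"
      using N(3) by (simp add: blinfun.add_left)
  qed
  then have addition: "N (x + y) u = \<Phi> x (N y u) + N x (\<Phi> y u)" for x y u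
    by (simp add: blinfun.add_left commute)
  have "N x + \<mu> x *\<^sub>C N (- x) = 0" for x
  proof (rule eqI)
    fix v assume "v \<in> V"
    then have "N (- x) v = (- 1 / \<mu> x) *\<^sub>C N x v" by (intro N(3) partial_sine.minus[OF \<Gamma> in_\<Gamma>])
    then have "\<mu> x *\<^sub>C N (- x) v = (-1) *\<^sub>C N x v" by (simp add: scaleC_scaleC)
    then show "(N x + \<mu> x *\<^sub>C N (- x)) v = blinfun_apply 0 v"
      by (simp add: blinfun.add_left scaleC_blinfun.rep_eq scaleC_minus_left)
  qed
  then have "N x u + \<mu> x *\<^sub>C N (- x) u = 0" for x u
    by (metis blinfun.add_left blinfun.zero_left scaleC_blinfun.rep_eq)
  then show ?thesis using that N(1,2) commute product addition unfolding sine_at_def by metis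
qed

text \<open>
  By multiplicativity \<open>M x - M a = M a (M (x - a) - 1)\<close>, so continuity only has to be checked at
  \<open>0\<close>, where the norm of \<open>N\<close> is controlled by the continuous function \<open>sine_bound\<close>.
\<close>

theorem exists_multiplicative_operator:
  "\<exists>M. multiplicative_operator M \<and> (\<forall>x. \<Phi> x = (1 / 2) *\<^sub>R (M x + \<mu> x *\<^sub>C M (- x)))"
proof -
  obtain N where N: "\<And>x. N x \<in> bounded_operators" "\<And>x. norm (N x) \<le> sine_bound x" "\<And>u. sine_at N u"
    "\<And>x y u. N x (\<Phi> y u) = \<Phi> y (N x u)" using global_sine by blast
  define M where "M x = \<Phi> x + N x" for x
  have mult: "M (x + y) = M x o\<^sub>L M y" for x y
  proof (rule blinfun_eqI)
    fix u
    have "N x (N y u) = \<Phi> (x + y) u - \<Phi> x (\<Phi> y u)" "N (x + y) u = \<Phi> x (N y u) + N x (\<Phi> y u)"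
      using N(3)[of u] by (simp_all add: sine_at_def D_apply)
    then show "M (x + y) u = (M x o\<^sub>L M y) u"
      by (simp add: M_def blinfun.bilinear_simps)
  qed
  have "norm (N 0) \<le> 0" using N(2)[of 0] by (simp add: sine_bound_def)
  then have M0: "M 0 = id_blinfun" by (simp add: M_def)
  have cont_\<Phi>: "continuous_on UNIV \<Phi>" using cosine by (simp add: operator_cosine_function_def)
  have cont_sine_bound: "continuous_on UNIV sine_bound"
    unfolding sine_bound_def D_def
    by (intro continuous_intros continuous_on_compose2[OF cont_\<Phi>] cont_\<Phi>
        bounded_bilinear.continuous_on[OF bounded_bilinear_blinfun_compose]) simp_all
  have "(M \<longlongrightarrow> M a) (at a)" for a
  proof -
    define h where "h x = norm (M a) * (norm (\<Phi> (x - a) - id_blinfun) + sine_bound (x - a))" for x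
    have bound: "norm (M x - M a) \<le> h x" for x
    proof -
      have "M x - M a = M a o\<^sub>L (M (x - a) - id_blinfun)"
        using mult[of a "x - a"] by (intro blinfun_eqI) (simp add: blinfun.bilinear_simps)
      then have "norm (M x - M a) \<le> norm (M a) * norm (M (x - a) - id_blinfun)"
        by (simp add: norm_blinfun_compose)
      also have "norm (M (x - a) - id_blinfun) \<le> norm (\<Phi> (x - a) - id_blinfun) + sine_bound (x - a)"
        using norm_triangle_ineq[of "\<Phi> (x - a) - id_blinfun" "N (x - a)"] N(2)[of "x - a"]
        by (simp add: M_def algebra_simps)
      finally show ?thesis by (simp add: h_def mult_left_mono)
    qed
    have "continuous_on UNIV h"
      unfolding h_def
      by (intro continuous_intros continuous_on_compose2[OF cont_\<Phi>]
          continuous_on_compose2[OF cont_sine_bound]) simp_all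
    then have "(h \<longlongrightarrow> h a) (at a)" by (simp add: continuous_on_def)
    moreover have "h a = 0" by (simp add: h_def sine_bound_def)
    ultimately have h0: "(h \<longlongrightarrow> 0) (at a)" by (simp only:)
    have "((\<lambda>x. M x - M a) \<longlongrightarrow> 0) (at a)"
      by (rule Lim_null_comparison[OF _ h0]) (simp add: bound)
    then show ?thesis by (rule Lim_null[THEN iffD2])
  qed
  then have "continuous_on UNIV M" by (simp add: continuous_on_def)
  moreover have "M x \<in> bounded_operators" for x
    using N(1)[of x] Phi_bounded[of x]
    by (simp add: M_def bounded_operators_def blinfun.add_left scaleC_add_right)
  ultimately have "multiplicative_operator M"
    by (simp add: multiplicative_operator_def mult M0)
  moreover have "\<Phi> x = (1 / 2) *\<^sub>R (M x + \<mu> x *\<^sub>C M (- x))" for x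
  proof (rule blinfun_eqI)
    fix u
    have "N x u + \<mu> x *\<^sub>C N (- x) u = 0" using N(3)[of u] by (simp add: sine_at_def)
    moreover have "\<mu> x *\<^sub>C \<Phi> (- x) u = \<Phi> x u" by (simp add: Phi_reflect scaleC_scaleC)
    ultimately have "M x u + \<mu> x *\<^sub>C M (- x) u = 2 *\<^sub>R \<Phi> x u"
      by (simp add: M_def blinfun.add_left scaleC_add_right scaleR_2 algebra_simps)
    then show "\<Phi> x u = ((1 / 2) *\<^sub>R (M x + \<mu> x *\<^sub>C M (- x))) u"
      by (simp add: blinfun.scaleR_left blinfun.add_left scaleC_blinfun.rep_eq)
  qed
  ultimately show ?thesis by blast
qed

end

theorem theorem3p1:
  fixes \<mu> :: "'g::topological_ab_group_add \<Rightarrow> complex"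
    and \<Phi> :: "'g \<Rightarrow> 'h::chilbert_space \<Rightarrow>\<^sub>L 'h"
  assumes "continuous_character \<mu>"
    and "operator_cosine_function \<mu> \<Phi>"
    and "hermitian \<Phi>"
  shows "\<exists>M :: 'g \<Rightarrow> 'h \<Rightarrow>\<^sub>L 'h. multiplicative_operator M \<and>
    (\<forall>x. \<Phi> x = (1 / 2) *\<^sub>R (M x + \<mu> x *\<^sub>C M (- x)))"
proof -
  interpret hermitian_cosine \<mu> \<Phi> by unfold_locales (fact assms)+
  show ?thesis by (rule exists_multiplicative_operator)
qed

end
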